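(* Let $C$ be a bifiltered chain complex (given by a finitely generated chain complex $C_*$ with an explicit finite set of generators over a field $\mathbb{F}$, and a value function $v$ with values in $\mathbb{R}^2$), and let $\bar{C}$ be the bifiltered chain complex obtained by applying the chunk algorithm to $C$. Then for every $p\in\mathbb{R}^2$ and every $k$, $$\delta^p_k(C)=\gamma^p_k(\bar{C}).$$
   Context: Bifiltered chain complexes. Fix a field $\mathbb{F}$. A (finitely generated) chain complex $C_*=(C_k,\partial_k)_{0\le k\le d}$ consists of the $\mathbb{F}$-vector spaces $C_k$ spanned by given finite sets of $k$-generators, and linear maps $\partial_k:C_k\to C_{k-1}$ with $\partial_{k-1}\partial_k=0$. For a chain $c$ and a generator $g$ of the same dimension, $\langle c,g\rangle\in\mathbb{F}$ is the coefficient of $g$ in $c$; "$g'$ is in the boundary of $g$" means $\langle\partial g,g'\rangle\ne 0$. On $\mathbb{R}^2$, $p\le q$ means $p_x\le q_x$ and $p_y\le q_y$, and $q<p$ means $q\le p$ and $q\ne p$. A value function assigns to each generator $g$ a value $v(g)\in\mathbb{R}^2$ such that $\langle\partial_k g,g'\rangle\ne0$ implies $v(g')\le v(g)$; the value $v(c)$ of a chain $c$ is the least common upper bound of the values of the generators in its support. For $p\in\mathbb{R}^2$, $C^p_*$ is the subcomplex of chains of value $\le p$ (the span of the generators $g$ with $v(g)\le p$). The collection $C=(C^p_* )_{p\in\mathbb{R}^2}$ is the bifiltered chain complex. The quantities $\delta$ and $\gamma$. For a bifiltered chain complex $D$ and $p\in\mathbb{R}^2$, let $D^{<p}_*:=\sum_{q<p}D^q_*$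 (the subcomplex spanned by the union of the generators of the summands), and let $\eta^p_k:H_k(D^{<p}_* )\to H_k(D^p_* )$ be the map induced by inclusion. Then $$\delta^p_k(D):=\dim\ker\eta^p_{k-1}+\dim\operatorname{coker}\eta^p_k,\qquad \gamma^p_k(D):=\dim D^p_k-\dim D^{<p}_k.$$ The chunk algorithm. Fix an injective index function $i$ from the generators to a totally ordered set, such that $v(c_1)\le v(c_2)$ and $v(c_1)\neq v(c_2)$ imply $i(c_1)<i(c_2)$. Each $k$-generator $c$ is stored as a "$k$-column" (its index, value, dimension and its boundary, a linear combination of $(k-1)$-generators); generators and columns are identified. The local pivot of a column $c$ is the generator $c'$ of maximal index in the (current) boundary of $c$ among those with $v(c')=v(c)$, if there is one. A column addition $c\gets c+\lambda c'$ (with $c,c'$ columns of the same dimension, $\lambda\in\mathbb{F}$) replaces the stored boundary of $c$ by itself plus $\lambda$ times the stored boundary of $c'$; no other column is changed. Phase I (local reduction). All columns start unlabeled. For $k=d,d-1,\dots,0$, traverse the $k$-columns in increasing index order. For a $k$-column $c$: if $c$ is already labeled, do nothing. Otherwise, as long as $c$ has a local pivot and there is a (local negative) $k$-column $c'$ with $i(c')<i(c)$ having the same local pivot, perform $c\gets c+\lambda c'$ with $\lambda$ chosen so that this local pivot disappears from the boundary of $c$. If in the end $c$ has no local pivot, label $c$ global; otherwise label $c$ local negative and its local pivot local positive. Phase II (compression). For each global $k$-column $c$: while the boundary of $c$ contains a local (positive or negative) generator, let $c'$ be the one of maximal index. If $c'$ is local negative, remove $c'$ from the boundary of $c$ (set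 its coefficient to $0$). If $c'$ is local positive, let $c''$ be the unique local negative $k$-column with local pivot $c'$ and perform $c\gets c+\lambda c''$ with $\lambda$ chosen so that $c'$ disappears from the boundary of $c$. Phase III. Delete all local (positive and negative) columns. The output $\bar{C}$ is the bifiltered chain complex whose generators are the global generators, with their original values and dimensions and their current stored boundaries. *)

theory Defs
  imports
    "Jordan_Normal_Form.VS_Connect"
    "HOL-Algebra.AbelCoset"
    "HOL-Library.Product_Order"
    "HOL-Library.While_Combinator"
begin

text \<open>
  Chains over the field \<open>'f\<close> are coefficient functions \<open>'g \<Rightarrow> 'f\<close>, so the coefficient of \<open>g\<close> in \<open>c\<close>
  is \<open>c g\<close>, and \<open>bd C g\<close> is the boundary chain of the generator \<open>g\<close>. Values are compared by the
  componentwise order of \<^theory>\<open>HOL-Library.Product_Order\<close>.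
\<close>

record ('f, 'g) bicomplex =
  gens :: "'g set"
  top_dim :: nat
  gen_dim :: "'g \<Rightarrow> nat"
  bd :: "'g \<Rightarrow> 'g \<Rightarrow> 'f"
  val :: "'g \<Rightarrow> real \<times> real"

definition boundary :: "('f::field, 'g, 'z) bicomplex_scheme \<Rightarrow> ('g \<Rightarrow> 'f) \<Rightarrow> 'g \<Rightarrow> 'f" where
  "boundary C c = (\<lambda>h. \<Sum>g\<in>gens C. c g * bd C g h)"

locale bifiltered_complex =
  fixes C :: "('f::field, 'g, 'z) bicomplex_scheme"
  assumes finite_gens: "finite (gens C)"
    and gen_dim_le: "g \<in> gens C \<Longrightarrow> gen_dim C g \<le> top_dim C"
    and bd_gens: "g \<in> gens C \<Longrightarrow> bd C g h \<noteq> 0 \<Longrightarrow> h \<in> gens C"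
    and bd_gen_dim: "g \<in> gens C \<Longrightarrow> bd C g h \<noteq> 0 \<Longrightarrow> gen_dim C g = Suc (gen_dim C h)"
    and bd_val: "g \<in> gens C \<Longrightarrow> bd C g h \<noteq> 0 \<Longrightarrow> val C h \<le> val C g"
    and boundary_bd: "g \<in> gens C \<Longrightarrow> boundary C (bd C g) = (\<lambda>h. 0)"


subsection \<open>Homology of subcomplexes\<close>

text \<open>
  Subcomplexes are given by the set \<open>S\<close> of their generators. Degrees are integers, so that the
  chain spaces in negative degrees are zero and degree \<open>0\<close> needs no special treatment.
\<close>

definition chain_space ::
  "('f::field, 'g, 'z) bicomplex_scheme \<Rightarrow> 'g set \<Rightarrow> int \<Rightarrow> ('f, 'g \<Rightarrow> 'f) module" where
  "chain_space C S k =
    \<lparr>carrier = {c. \<forall>g. c g \<noteq> 0 \<longrightarrow> g \<in> S \<and> int (gen_dim C g) = k},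
     mult = undefined, one = undefined,
     zero = (\<lambda>g. 0), add = (\<lambda>c c' g. c g + c' g),
     smult = (\<lambda>a c g. a * c g)\<rparr>"

definition cycles ::
  "('f::field, 'g, 'z) bicomplex_scheme \<Rightarrow> 'g set \<Rightarrow> int \<Rightarrow> ('g \<Rightarrow> 'f) set" where
  "cycles C S k = {c \<in> carrier (chain_space C S k). boundary C c = (\<lambda>h. 0)}"

definition boundaries ::
  "('f::field, 'g, 'z) bicomplex_scheme \<Rightarrow> 'g set \<Rightarrow> int \<Rightarrow> ('g \<Rightarrow> 'f) set" where
  "boundaries C S k = boundary C ` carrier (chain_space C S (k + 1))"

definition quotient_space :: "('a, 'm, 'z) module_scheme \<Rightarrow> 'm set \<Rightarrow> ('a, 'm set) module" where
  "quotient_space M N =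
    \<lparr>carrier = a_rcosets\<^bsub>M\<^esub> N,
     mult = undefined, one = undefined,
     zero = N, add = set_add M,
     smult = (\<lambda>a X. \<Union>x\<in>X. N +>\<^bsub>M\<^esub> (a \<odot>\<^bsub>M\<^esub> x))\<rparr>"

definition homology ::
  "('f::field, 'g, 'z) bicomplex_scheme \<Rightarrow> 'g set \<Rightarrow> int \<Rightarrow> ('f, ('g \<Rightarrow> 'f) set) module" where
  "homology C S k =
    quotient_space ((chain_space C S k)\<lparr>carrier := cycles C S k\<rparr>) (boundaries C S k)"

definition sublevel :: "('f::field, 'g, 'z) bicomplex_scheme \<Rightarrow> real \<times> real \<Rightarrow> 'g set" where
  "sublevel C p = {g \<in> gens C. val C g \<le> p}"

definition strict_sublevel :: "('f::field, 'g, 'z) bicomplex_scheme \<Rightarrow> real \<times> real \<Rightarrow> 'g set" where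
  "strict_sublevel C p = (\<Union>q\<in>{q. q < p}. sublevel C q)"

text \<open>The class of \<open>z\<close> in the smaller complex, a coset \<open>X\<close>, is sent to the class of \<open>z\<close> in the larger one;
  the union below does not depend on the choice of \<open>z\<close>.\<close>

definition eta ::
  "('f::field, 'g, 'z) bicomplex_scheme \<Rightarrow> real \<times> real \<Rightarrow> int \<Rightarrow> ('g \<Rightarrow> 'f) set \<Rightarrow> ('g \<Rightarrow> 'f) set" where
  "eta C p k X =
    (\<Union>z\<in>X. boundaries C (sublevel C p) k +>\<^bsub>chain_space C (sublevel C p) k\<^esub> z)"

definition eta_kernel ::
  "('f::field, 'g, 'z) bicomplex_scheme \<Rightarrow> real \<times> real \<Rightarrow> int \<Rightarrow> ('f, ('g \<Rightarrow> 'f) set) module" where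
  "eta_kernel C p k =
    (let H = homology C (strict_sublevel C p) k; H' = homology C (sublevel C p) k
     in H\<lparr>carrier := a_kernel H H' (eta C p k)\<rparr>)"

definition eta_cokernel ::
  "('f::field, 'g, 'z) bicomplex_scheme \<Rightarrow> real \<times> real \<Rightarrow> int \<Rightarrow> ('f, ('g \<Rightarrow> 'f) set set) module" where
  "eta_cokernel C p k =
    quotient_space (homology C (sublevel C p) k)
      (eta C p k ` carrier (homology C (strict_sublevel C p) k))"

definition delta :: "('f::field, 'g, 'z) bicomplex_scheme \<Rightarrow> real \<times> real \<Rightarrow> int \<Rightarrow> nat" where
  "delta C p k =
    vectorspace.dim class_ring (eta_kernel C p (k - 1)) +
    vectorspace.dim class_ring (eta_cokernel C p k)"

definition gamma :: "('f::field, 'g, 'z) bicomplex_scheme \<Rightarrow> real \<times> real \<Rightarrow> int \<Rightarrow> int" where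
  "gamma C p k =
    int (vectorspace.dim class_ring (chain_space C (sublevel C p) k)) -
    int (vectorspace.dim class_ring (chain_space C (strict_sublevel C p) k))"


subsection \<open>The chunk algorithm\<close>

definition index_function ::
  "('f::field, 'g, 'z) bicomplex_scheme \<Rightarrow> ('g \<Rightarrow> 'i::linorder) \<Rightarrow> bool" where
  "index_function C i \<longleftrightarrow> inj_on i (gens C) \<and>
    (\<forall>c1\<in>gens C. \<forall>c2\<in>gens C. val C c1 \<le> val C c2 \<and> val C c1 \<noteq> val C c2 \<longrightarrow> i c1 < i c2)"

datatype label = Unlabeled | Global | LocalNegative | LocalPositive

record ('f, 'g) chunk_state =
  stored :: "'g \<Rightarrow> 'g \<Rightarrow> 'f"
  lab :: "'g \<Rightarrow> label"

definition columns :: "('f::field, 'g, 'z) bicomplex_scheme \<Rightarrow> nat \<Rightarrow> 'g set" where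
  "columns C k = {c \<in> gens C. gen_dim C c = k}"

text \<open>\<open>local_pivot C i c x\<close> is the local pivot of the column \<open>c\<close> when its stored boundary is \<open>x\<close>.\<close>

definition local_pivot ::
  "('f::field, 'g, 'z) bicomplex_scheme \<Rightarrow> ('g \<Rightarrow> 'i::linorder) \<Rightarrow> 'g \<Rightarrow> ('g \<Rightarrow> 'f) \<Rightarrow> 'g option" where
  "local_pivot C i c x =
    (let L = {h \<in> gens C. x h \<noteq> 0 \<and> val C h = val C c}
     in if L = {} then None else Some (arg_max_on i L))"

text \<open>The addition \<open>x + \<lambda> y\<close> that cancels \<open>g\<close>.\<close>

definition eliminate :: "('g \<Rightarrow> 'f::field) \<Rightarrow> ('g \<Rightarrow> 'f) \<Rightarrow> 'g \<Rightarrow> 'g \<Rightarrow> 'f" where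
  "eliminate x y g = (\<lambda>h. x h + (- (x g / y g)) * y h)"

definition reducers ::
  "('f::field, 'g, 'z) bicomplex_scheme \<Rightarrow> ('g \<Rightarrow> 'i::linorder) \<Rightarrow> ('f, 'g) chunk_state \<Rightarrow>
    'g \<Rightarrow> ('g \<Rightarrow> 'f) \<Rightarrow> 'g set" where
  "reducers C i s c x =
    {c' \<in> columns C (gen_dim C c). lab s c' = LocalNegative \<and> i c' < i c \<and>
      local_pivot C i c x \<noteq> None \<and> local_pivot C i c' (stored s c') = local_pivot C i c x}"

definition reduce_column ::
  "('f::field, 'g, 'z) bicomplex_scheme \<Rightarrow> ('g \<Rightarrow> 'i::linorder) \<Rightarrow> ('f, 'g) chunk_state \<Rightarrow>
    'g \<Rightarrow> 'g \<Rightarrow> 'f" where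
  "reduce_column C i s c =
    while (\<lambda>x. reducers C i s c x \<noteq> {})
      (\<lambda>x. eliminate x (stored s (SOME c'. c' \<in> reducers C i s c x)) (the (local_pivot C i c x)))
      (stored s c)"

definition process_column ::
  "('f::field, 'g, 'z) bicomplex_scheme \<Rightarrow> ('g \<Rightarrow> 'i::linorder) \<Rightarrow> 'g \<Rightarrow>
    ('f, 'g) chunk_state \<Rightarrow> ('f, 'g) chunk_state" where
  "process_column C i c s =
    (if lab s c \<noteq> Unlabeled then s
     else let x = reduce_column C i s c in
       (case local_pivot C i c x of
          None \<Rightarrow> \<lparr>stored = (stored s)(c := x), lab = (lab s)(c := Global)\<rparr>
        | Some h \<Rightarrow> \<lparr>stored = (stored s)(c := x),
                     lab = (lab s)(c := LocalNegative, h := LocalPositive)\<rparr>))"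

definition phase1 ::
  "('f::field, 'g, 'z) bicomplex_scheme \<Rightarrow> ('g \<Rightarrow> 'i::linorder) \<Rightarrow> ('f, 'g) chunk_state" where
  "phase1 C i =
    fold (\<lambda>k. fold (process_column C i) (sorted_key_list_of_set i (columns C k)))
      (rev [0..<Suc (top_dim C)])
      \<lparr>stored = bd C, lab = (\<lambda>g. Unlabeled)\<rparr>"

definition local_support ::
  "('f::field, 'g, 'z) bicomplex_scheme \<Rightarrow> ('f, 'g) chunk_state \<Rightarrow> ('g \<Rightarrow> 'f) \<Rightarrow> 'g set" where
  "local_support C s x = {h \<in> gens C. x h \<noteq> 0 \<and> lab s h \<in> {LocalNegative, LocalPositive}}"

definition compress_column ::
  "('f::field, 'g, 'z) bicomplex_scheme \<Rightarrow> ('g \<Rightarrow> 'i::linorder) \<Rightarrow> ('f, 'g) chunk_state \<Rightarrow>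
    'g \<Rightarrow> 'g \<Rightarrow> 'f" where
  "compress_column C i s c =
    while (\<lambda>x. local_support C s x \<noteq> {})
      (\<lambda>x. let c' = arg_max_on i (local_support C s x) in
         if lab s c' = LocalNegative then x(c' := 0)
         else eliminate x
           (stored s (THE c''. c'' \<in> columns C (gen_dim C c) \<and> lab s c'' = LocalNegative \<and>
              local_pivot C i c'' (stored s c'') = Some c')) c')
      (stored s c)"

text \<open>Compressing a global column reads and changes no other global column, so the global columns may
  be compressed simultaneously, whatever the order of traversal.\<close>

definition phase2 ::
  "('f::field, 'g, 'z) bicomplex_scheme \<Rightarrow> ('g \<Rightarrow> 'i::linorder) \<Rightarrow>
    ('f, 'g) chunk_state \<Rightarrow> ('f, 'g) chunk_state" where
  "phase2 C i s =
    s\<lparr>stored := (\<lambda>c. if c \<in> gens C \<and> lab s c = Global then compress_column C i s c else stored s c)\<rparr>"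

definition chunk ::
  "('f::field, 'g) bicomplex \<Rightarrow> ('g \<Rightarrow> 'i::linorder) \<Rightarrow> ('f, 'g) bicomplex" where
  "chunk C i =
    (let s = phase2 C i (phase1 C i)
     in C\<lparr>gens := {g \<in> gens C. lab s g = Global}, bd := stored s\<rparr>)"

end

theory Submission
  imports Defs
begin

text \<open>
  Only the generators of value exactly \<open>p\<close> matter. The quotient of the complex at \<open>p\<close> by the complex
  strictly below \<open>p\<close> is spanned by them, and its boundary, here called the relative boundary, keeps
  from the boundary of a chain the coefficients at generators of value \<open>p\<close>. By the long exact
  sequence, \<open>delta C p k\<close> is the dimension of the homology of this quotient in degree \<open>k\<close>, hence
  \<open>n\<^sub>k - r\<^sub>k - r\<^sub>k\<^sub>+\<^sub>1\<close>, where \<open>n\<^sub>k\<close> is the number of generators of value \<open>p\<close> and dimension \<open>k\<close> and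
  \<open>r\<^sub>k\<close> is the rank of the relative boundary in degree \<open>k\<close>. The proof of this formula in
  \<open>delta_relative_rank\<close> replaces the exact sequence by a count of dimensions with rank-nullity.

  The local reduction is the usual column reduction of the matrices of these quotient complexes,
  for all \<open>p\<close> at once: a local pivot has the value of its column, and only columns of one value are
  added to each other. For the columns of value \<open>p\<close> and dimension \<open>k\<close> it follows that
  \<open>r\<^sub>k\<close> is the number of local negative ones:

  \<^item> The local negative columns are independent after restriction to the value \<open>p\<close>, because their
    pivots are distinct (\<open>negative_columns_independent\<close>).

  \<^item> They span the image of the relative boundary (\<open>relative_boundary_image_eq_negative_span\<close>).
    A global column has been reduced to a column without entries of value \<open>p\<close>. A local positive
    column was skipped by the reduction, but it is the pivot of a column of dimension \<open>k + 1\<close>. That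
    column is a cycle, so it expresses the relative boundary of its pivot by those of generators of
    smaller index (\<open>positive_column_redundant\<close>).

  The pivots match the local negative columns of dimension \<open>k + 1\<close> with the local positive ones of
  dimension \<open>k\<close>, so \<open>r\<^sub>k\<^sub>+\<^sub>1\<close> is the number of the latter. Every column is labelled in the end, and
  therefore \<open>n\<^sub>k - r\<^sub>k - r\<^sub>k\<^sub>+\<^sub>1\<close> counts the global columns of value \<open>p\<close> and dimension \<open>k\<close>. The compression
  keeps labels, values and dimensions, so that this is also \<open>gamma\<close> of the output.
\<close>

section \<open>Dimensions of quotient spaces\<close>

text \<open>
  Sets that are linearly independent in the subspace are so in the whole space, which bounds their
  size; a largest one is a finite basis of the subspace.
\<close>

lemma (in vectorspace) subspace_fin_dim:
  assumes fin: "fin_dim" and sub: "subspace K W V"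
  shows "vectorspace.fin_dim K (vs W)"
proof -
  interpret W: vectorspace K "vs W" by (rule subspace_is_vs[OF sub])
  have W_sub: "submodule K W V" using sub by (simp add: subspace_def)
  then have W_carrier: "W \<subseteq> carrier V" by (simp add: submodule_def)
  have small: "finite S \<and> card S \<le> dim" if S: "S \<subseteq> W \<and> W.lin_indpt S" for S
  proof -
    have "lin_indpt S" using span_li_not_depend(2)[OF _ W_sub, of S] S by blast
    then show ?thesis using li_le_dim[OF fin] S W_carrier by blast
  qed
  have "W.lin_indpt {}" by (auto simp: W.lin_dep_def)
  then have "\<exists>S. finite S \<and> maximal S (\<lambda>S. S \<subseteq> W \<and> W.lin_indpt S)"
    using small by (intro maximal_exists[where B = "{}" and N = dim]) auto
  then obtain S where S: "finite S" "maximal S (\<lambda>S. S \<subseteq> carrier (vs W) \<and> W.lin_indpt S)"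
    by auto
  then have "W.basis S" by (intro W.max_li_is_basis) auto
  then show ?thesis using S(1) unfolding W.fin_dim_def W.basis_def by blast
qed

lemma linear_mapI:
  assumes "vectorspace K V" "vectorspace K W" "T \<in> LinearCombinations.module_hom K V W"
  shows "linear_map K V W T"
  using assms by (intro linear_map.intro mod_hom.intro mod_hom_axioms.intro vectorspace.axioms(1))

text \<open>
  The laws of a vector space pass from representatives to their images. This is the form in which
  they hold for cosets.
\<close>

lemma linear_map_onto_imageI:
  assumes V: "vectorspace K V"
    and image: "carrier Q = \<pi> ` carrier V"
    and zero: "\<zero>\<^bsub>Q\<^esub> = \<pi> \<zero>\<^bsub>V\<^esub>"
    and add: "\<And>x y. x \<in> carrier V \<Longrightarrow> y \<in> carrier V \<Longrightarrow> \<pi> x \<oplus>\<^bsub>Q\<^esub> \<pi> y = \<pi> (x \<oplus>\<^bsub>V\<^esub> y)"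
    and smult: "\<And>a x. a \<in> carrier K \<Longrightarrow> x \<in> carrier V \<Longrightarrow> a \<odot>\<^bsub>Q\<^esub> \<pi> x = \<pi> (a \<odot>\<^bsub>V\<^esub> x)"
  shows "linear_map K V Q \<pi>"
proof -
  interpret V: vectorspace K V by (rule V)
  have "vectorspace K Q"
  proof (rule vs_criteria)
    show "field K" by (rule V.field_axioms)
    show "\<forall>v\<in>carrier Q. \<exists>w\<in>carrier Q. v \<oplus>\<^bsub>Q\<^esub> w = \<zero>\<^bsub>Q\<^esub>"
    proof
      fix v assume "v \<in> carrier Q"
      then obtain x where x: "x \<in> carrier V" "v = \<pi> x" by (auto simp: image)
      have "v \<oplus>\<^bsub>Q\<^esub> \<pi> (\<ominus>\<^bsub>V\<^esub> x) = \<zero>\<^bsub>Q\<^esub>"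
        using x V.M.a_inv_closed[OF x(1)] by (simp only: x(2) add zero V.M.r_neg)
      then show "\<exists>w\<in>carrier Q. v \<oplus>\<^bsub>Q\<^esub> w = \<zero>\<^bsub>Q\<^esub>"
        using x by (intro bexI[of _ "\<pi> (\<ominus>\<^bsub>V\<^esub> x)"]) (simp_all add: image)
    qed
  next
    show "\<zero>\<^bsub>Q\<^esub> \<in> carrier Q" by (simp add: zero image)
  next
    show "\<forall>v w. v \<in> carrier Q \<and> w \<in> carrier Q \<longrightarrow> v \<oplus>\<^bsub>Q\<^esub> w = w \<oplus>\<^bsub>Q\<^esub> v"
      by (clarsimp simp: image add V.M.a_comm)
  next
    show "\<forall>v w x. v \<in> carrier Q \<and> w \<in> carrier Q \<and> x \<in> carrier Q \<longrightarrow>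
        v \<oplus>\<^bsub>Q\<^esub> w \<oplus>\<^bsub>Q\<^esub> x = v \<oplus>\<^bsub>Q\<^esub> (w \<oplus>\<^bsub>Q\<^esub> x)"
      by (clarsimp simp: image add V.M.a_assoc)
  qed (clarsimp simp: image zero add smult V.smult_assoc1 V.smult_l_distr V.smult_r_distr)+
  then interpret Q: vectorspace K Q .
  have "\<pi> \<in> LinearCombinations.module_hom K V Q"
    unfolding LinearCombinations.module_hom_def image by (simp add: add smult)
  then show ?thesis
    by (rule linear_mapI[OF V Q.vectorspace_axioms])
qed

lemma (in vectorspace) linear_map_quotient_space:
  assumes sub: "submodule K N V"
  shows "linear_map K V (quotient_space V N) (\<lambda>x. N +>\<^bsub>V\<^esub> x)" (is "linear_map K V ?Q ?\<pi>")
    and "carrier (quotient_space V N) = (\<lambda>x. N +>\<^bsub>V\<^esub> x) ` carrier V"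
    and "{x \<in> carrier V. N +>\<^bsub>V\<^esub> x = \<zero>\<^bsub>quotient_space V N\<^esub>} = N"
proof -
  have N: "N \<subseteq> carrier V" "\<zero>\<^bsub>V\<^esub> \<in> N" using sub by (auto simp: submodule_def)
  have "abelian_subgroup N V"
  proof (rule abelian_subgroupI3)
    have "additive_subgroup N V"
    proof (rule additive_subgroup.intro, rule M.add.subgroupI)
      show "\<ominus>\<^bsub>V\<^esub> a \<in> N" if "a \<in> N" for a
      proof -
        have "(\<ominus>\<^bsub>K\<^esub> \<one>\<^bsub>K\<^esub>) \<odot>\<^bsub>V\<^esub> a \<in> N"
          using that by (intro submodule.smult_closed[OF sub]) auto
        then show ?thesis using that N(1) smult_minus_1[of a] by auto
      qed
    qed (use sub in \<open>auto simp: submodule_def\<close>)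
    then show "additive_subgroup N V" .
    show "abelian_group V" by (rule M.abelian_group_axioms)
  qed
  then interpret N: abelian_subgroup N V .
  show carrier_Q: "carrier ?Q = ?\<pi> ` carrier V"
    by (auto simp: quotient_space_def A_RCOSETS_def')
  have coset_0: "?\<pi> \<zero>\<^bsub>V\<^esub> = N" using N(1) by simp
  have add: "?\<pi> x \<oplus>\<^bsub>?Q\<^esub> ?\<pi> y = ?\<pi> (x \<oplus>\<^bsub>V\<^esub> y)" if "x \<in> carrier V" "y \<in> carrier V" for x y
    using N.a_rcos_sum[OF that] by (simp add: quotient_space_def)
  have smult: "a \<odot>\<^bsub>?Q\<^esub> ?\<pi> x = ?\<pi> (a \<odot>\<^bsub>V\<^esub> x)" if a: "a \<in> carrier K" and x: "x \<in> carrier V" for a x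
  proof -
    \<comment> \<open>The scalar multiple of a coset is a union of cosets, one for each element; they all coincide.\<close>
    have "?\<pi> (a \<odot>\<^bsub>V\<^esub> y) = ?\<pi> (a \<odot>\<^bsub>V\<^esub> x)" if y: "y \<in> ?\<pi> x" for y
    proof -
      obtain n where n: "n \<in> N" "y = n \<oplus>\<^bsub>V\<^esub> x" using y by (auto simp: a_r_coset_def')
      have "a \<odot>\<^bsub>V\<^esub> y = a \<odot>\<^bsub>V\<^esub> n \<oplus>\<^bsub>V\<^esub> a \<odot>\<^bsub>V\<^esub> x"
        using n a x N(1) by (auto simp: smult_r_distr)
      moreover have "a \<odot>\<^bsub>V\<^esub> n \<in> N" using sub n a by (simp add: submodule_def)
      ultimately have "a \<odot>\<^bsub>V\<^esub> y \<in> ?\<pi> (a \<odot>\<^bsub>V\<^esub> x)" by (auto simp: a_r_coset_def')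
      then show ?thesis using N.a_repr_independence'[of "a \<odot>\<^bsub>V\<^esub> y" "a \<odot>\<^bsub>V\<^esub> x"] a x by simp
    qed
    moreover have "x \<in> ?\<pi> x" using x by (rule N.a_rcos_self)
    ultimately have "(\<Union>y\<in>?\<pi> x. ?\<pi> (a \<odot>\<^bsub>V\<^esub> y)) = ?\<pi> (a \<odot>\<^bsub>V\<^esub> x)" by blast
    then show ?thesis by (simp add: quotient_space_def)
  qed
  show "linear_map K V ?Q ?\<pi>"
    by (rule linear_map_onto_imageI[OF vectorspace_axioms carrier_Q _ add smult])
      (simp_all add: quotient_space_def coset_0)
  have "?\<pi> x = N \<longleftrightarrow> x \<in> N" if "x \<in> carrier V" for x
    using N.a_rcos_self[OF that] N.a_rcos_const[of x] by blast
  then show "{x \<in> carrier V. ?\<pi> x = \<zero>\<^bsub>?Q\<^esub>} = N"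
    using N(1) unfolding quotient_space_def by auto
qed

lemma (in linear_map) rank_nullity_image:
  assumes "V.fin_dim"
  shows "vectorspace.dim K (W\<lparr>carrier := T ` carrier V\<rparr>) +
    vectorspace.dim K (V\<lparr>carrier := {v \<in> carrier V. T v = \<zero>\<^bsub>W\<^esub>}\<rparr>) = V.dim"
  using rank_nullity[OF assms] by (simp add: im_def ker_def)

lemma (in vectorspace) quotient_space_dim:
  assumes fin: "fin_dim" and sub: "submodule K N V"
  shows "vectorspace K (quotient_space V N)"
    and "vectorspace.fin_dim K (quotient_space V N)"
    and "vectorspace.dim K (quotient_space V N) + vectorspace.dim K (vs N) = dim"
proof -
  let ?Q = "quotient_space V N"
  interpret \<pi>: linear_map K V ?Q "\<lambda>x. N +>\<^bsub>V\<^esub> x"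
    by (rule linear_map_quotient_space(1)[OF sub])
  note onto = linear_map_quotient_space(2)[OF sub] and ker = linear_map_quotient_space(3)[OF sub]
  show "vectorspace K ?Q" by (rule \<pi>.W.vectorspace_axioms)
  show "vectorspace.fin_dim K ?Q" by (rule \<pi>.surj_fin_dim[OF fin onto[symmetric]])
  show "vectorspace.dim K ?Q + vectorspace.dim K (vs N) = dim"
    using \<pi>.rank_nullity_image[OF fin] unfolding ker onto[symmetric] by simp
qed

section \<open>Spaces of chains\<close>

definition supported :: "'g set \<Rightarrow> ('g \<Rightarrow> 'f::field) set" where
  "supported F = {c. \<forall>g. c g \<noteq> 0 \<longrightarrow> g \<in> F}"

lemma supported_add_smult:
  assumes "x \<in> supported F" "y \<in> supported F"
  shows "(\<lambda>h. x h + t * y h) \<in> supported F"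
proof -
  have "x h \<noteq> 0 \<or> y h \<noteq> 0" if "x h + t * y h \<noteq> 0" for h using that by auto
  then show ?thesis using assms by (auto simp: supported_def)
qed

text \<open>
  Chain spaces, cycles and boundaries all carry these operations and differ only in the carrier.
\<close>

definition fun_module :: "('g \<Rightarrow> 'f::field) set \<Rightarrow> ('f, 'g \<Rightarrow> 'f) module" where
  "fun_module U =
    \<lparr>carrier = U, mult = undefined, one = undefined,
     zero = (\<lambda>g. 0), add = (\<lambda>c c' g. c g + c' g),
     smult = (\<lambda>a c g. a * c g)\<rparr>"

abbreviation fdim :: "('g \<Rightarrow> 'f::field) set \<Rightarrow> nat" where
  "fdim U \<equiv> vectorspace.dim class_ring (fun_module U)"

text \<open>
  The finite set \<open>F\<close> of generators that supports all elements makes the subspace finite-dimensional.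
\<close>

definition chain_subspace :: "'g set \<Rightarrow> ('g \<Rightarrow> 'f::field) set \<Rightarrow> bool" where
  "chain_subspace F U \<longleftrightarrow> finite F \<and> U \<subseteq> supported F \<and> (\<lambda>g. 0) \<in> U \<and>
    (\<forall>x\<in>U. \<forall>y\<in>U. (\<lambda>g. x g + y g) \<in> U) \<and> (\<forall>a. \<forall>x\<in>U. (\<lambda>g. a * x g) \<in> U)"

text \<open>
  Linearity on all functions at once, so that a single fact serves every subspace.
\<close>

definition chain_linear :: "(('g \<Rightarrow> 'f::field) \<Rightarrow> ('h \<Rightarrow> 'f)) \<Rightarrow> bool" where
  "chain_linear T \<longleftrightarrow> (\<forall>x y. T (\<lambda>g. x g + y g) = (\<lambda>h. T x h + T y h)) \<and>
    (\<forall>a x. T (\<lambda>g. a * x g) = (\<lambda>h. a * T x h))"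

lemma fun_module_simps [simp]:
  "carrier (fun_module U) = U" "\<zero>\<^bsub>fun_module U\<^esub> = (\<lambda>g. 0)"
  "x \<oplus>\<^bsub>fun_module U\<^esub> y = (\<lambda>g. x g + y g)" "a \<odot>\<^bsub>fun_module U\<^esub> x = (\<lambda>g. a * x g)"
  "(fun_module U)\<lparr>carrier := U'\<rparr> = fun_module U'"
  by (simp_all add: fun_module_def)

lemma vectorspace_fun_module:
  assumes "chain_subspace F U"
  shows "vectorspace class_ring (fun_module U)"
proof -
  have neg: "\<exists>w\<in>U. (\<lambda>g. v g + w g) = (\<lambda>g. 0)" if "v \<in> U" for v
  proof (rule bexI)
    show "(\<lambda>g. - 1 * v g) \<in> U" using assms that unfolding chain_subspace_def by blast
  qed simp
  show ?thesis
    by (rule vs_criteria)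
      (use assms neg class_field in \<open>auto simp: chain_subspace_def algebra_simps\<close>)
qed

lemma chain_subspace_supported: "finite F \<Longrightarrow> F' \<subseteq> F \<Longrightarrow> chain_subspace F (supported F')"
  by (auto simp: chain_subspace_def supported_def) (metis add_0)

lemma chain_subspace_sum:
  assumes W: "chain_subspace F W" and A: "finite A" and w: "\<And>g. g \<in> A \<Longrightarrow> a g \<noteq> 0 \<Longrightarrow> w g \<in> W"
  shows "(\<lambda>h. \<Sum>g\<in>A. a g * w g h) \<in> W"
  using A w
proof (induction A)
  case empty
  then show ?case using W by (simp add: chain_subspace_def)
next
  case (insert g A)
  have "(\<lambda>h. a g * w g h) \<in> W"
    using W insert.prems[of g] by (cases "a g = 0") (auto simp: chain_subspace_def)
  moreover have "(\<lambda>h. \<Sum>g\<in>A. a g * w g h) \<in> W" using insert by simp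
  ultimately show ?case using W insert.hyps by (simp add: chain_subspace_def)
qed

lemma chain_subspace_smult: "chain_subspace F W \<Longrightarrow> x \<in> W \<Longrightarrow> (\<lambda>h. t * x h) \<in> W"
  by (simp add: chain_subspace_def)

lemma chain_subspace_add_smult:
  assumes "chain_subspace F W" "x \<in> W" "y \<in> W"
  shows "(\<lambda>h. x h + t * y h) \<in> W"
proof -
  have "(\<lambda>h. t * y h) \<in> W" using assms by (simp add: chain_subspace_def)
  then show ?thesis using assms by (simp add: chain_subspace_def)
qed

lemma submodule_fun_module:
  assumes "chain_subspace F U" "chain_subspace F' N" "N \<subseteq> U"
  shows "submodule class_ring N (fun_module U)"
  using vectorspace_fun_module[OF assms(1)] assms
  by (intro submodule.intro) (auto simp: vectorspace_def chain_subspace_def)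

lemma finsum_fun_module:
  assumes "chain_subspace F U" "finite A" "f \<in> A \<rightarrow> U"
  shows "finsum (fun_module U) f A = (\<lambda>g. \<Sum>x\<in>A. f x g)"
proof -
  interpret vectorspace class_ring "fun_module U" by (rule vectorspace_fun_module[OF assms(1)])
  show ?thesis using assms(2,3)
  proof (induction A)
    case (insert x A)
    then have "finsum (fun_module U) f (insert x A) = f x \<oplus>\<^bsub>fun_module U\<^esub> finsum (fun_module U) f A"
      by (intro M.finsum_insert) auto
    then show ?case using insert by simp
  qed simp
qed

text \<open>
  The indicator functions of the elements of \<open>F\<close> form a basis.
\<close>

lemma fin_dim_supported:
  fixes F :: "'g set"
  assumes F: "finite F"
  shows "vectorspace.fin_dim class_ring (fun_module (supported F :: ('g \<Rightarrow> 'f::field) set))"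
    and "fdim (supported F :: ('g \<Rightarrow> 'f) set) = card F"
proof -
  let ?M = "fun_module (supported F :: ('g \<Rightarrow> 'f) set)"
  have sub: "chain_subspace F (supported F)" by (rule chain_subspace_supported[OF F]) simp
  interpret vectorspace class_ring ?M by (rule vectorspace_fun_module[OF sub])
  define e where "e g = (\<lambda>h. if h = g then 1 else 0 :: 'f)" for g :: 'g
  have inj: "inj e" by (rule injI) (metis e_def zero_neq_one)
  have e: "e ` F \<subseteq> carrier ?M" by (auto simp: e_def supported_def split: if_splits)
  have lc: "lincomb a (e ` F) = (\<lambda>h. if h \<in> F then a (e h) else 0)" for a
  proof -
    have "lincomb a (e ` F) = (\<lambda>h. \<Sum>x\<in>e ` F. a x * x h)"
    proof -
      have "a x \<odot>\<^bsub>?M\<^esub> x \<in> supported F" if "x \<in> e ` F" for x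
        using e that by (intro smult_closed[unfolded fun_module_simps(1)]) auto
      then show ?thesis
        unfolding lincomb_def using F by (subst finsum_fun_module[OF sub]) auto
    qed
    also have "\<dots> = (\<lambda>h. \<Sum>g\<in>F. a (e g) * e g h)"
      by (subst sum.reindex[OF inj_on_subset[OF inj]]) auto
    also have "\<dots> = (\<lambda>h. if h \<in> F then a (e h) else 0)"
      using F by (intro ext) (simp add: e_def if_distrib[of "\<lambda>x. _ * x"] cong: if_cong)
    finally show ?thesis .
  qed
  have "lin_indpt (e ` F)"
    using F e by (intro finite_lin_indpt2) (auto simp: lc fun_eq_iff split: if_splits)
  moreover have "span (e ` F) = carrier ?M"
  proof -
    have "c \<in> span (e ` F)" if "c \<in> supported F" for c
    proof -
      have "c = lincomb (c \<circ> inv_into UNIV e) (e ` F)"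
        using that unfolding lc by (auto simp: inj supported_def fun_eq_iff)
      then show ?thesis using F e by (subst finite_span) auto
    qed
    then show ?thesis using span_is_subset2[OF e] by auto
  qed
  ultimately have basis: "basis (e ` F)" using e by (simp add: basis_def)
  then show "fdim (supported F :: ('g \<Rightarrow> 'f) set) = card F"
    using dim_basis[OF _ basis] F card_image[OF inj_on_subset[OF inj]] by auto
  show "fin_dim" using basis F unfolding basis_def fin_dim_def by blast
qed

lemma fin_dim_fun_module:
  assumes "chain_subspace F U"
  shows "vectorspace.fin_dim class_ring (fun_module U)"
proof -
  have F: "finite F" and U: "U \<subseteq> supported F" using assms by (auto simp: chain_subspace_def)
  have sub: "chain_subspace F (supported F)" by (rule chain_subspace_supported[OF F]) simp
  note vs = vectorspace_fun_module[OF sub]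
  have "subspace class_ring U (fun_module (supported F))"
    by (rule subspace.intro[OF vs submodule_fun_module[OF sub assms U]])
  then show ?thesis
    using vectorspace.subspace_fin_dim[OF vs fin_dim_supported(1)[OF F]] by simp
qed

lemma chain_linear_zero: "chain_linear T \<Longrightarrow> T (\<lambda>g. 0) = (\<lambda>h. 0)"
proof -
  assume "chain_linear T"
  then have "T (\<lambda>g. a * x g) = (\<lambda>h. a * T x h)" for a x unfolding chain_linear_def by blast
  from this[of 0 "\<lambda>g. 0"] show ?thesis by simp
qed

lemma chain_subspace_image:
  assumes U: "chain_subspace F U" and T: "chain_linear T" and F': "finite F'" "T ` U \<subseteq> supported F'"
  shows "chain_subspace F' (T ` U)"
proof -
  have "(\<lambda>h. T x h + T y h) \<in> T ` U" if "x \<in> U" "y \<in> U" for x y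
  proof -
    have "(\<lambda>g. x g + y g) \<in> U" using U that by (simp add: chain_subspace_def)
    moreover have "(\<lambda>h. T x h + T y h) = T (\<lambda>g. x g + y g)" using T by (simp add: chain_linear_def)
    ultimately show ?thesis by (simp only: imageI)
  qed
  moreover have "(\<lambda>h. a * T x h) \<in> T ` U" if "x \<in> U" for a x
  proof -
    have "(\<lambda>g. a * x g) \<in> U" using U that by (simp add: chain_subspace_def)
    moreover have "(\<lambda>h. a * T x h) = T (\<lambda>g. a * x g)" using T by (simp add: chain_linear_def)
    ultimately show ?thesis by (simp only: imageI)
  qed
  moreover have "(\<lambda>h. 0) \<in> T ` U"
    using U chain_linear_zero[OF T, symmetric] by (simp add: chain_subspace_def)
  ultimately show ?thesis using F' by (auto simp: chain_subspace_def)
qed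

lemma chain_subspace_kernel:
  assumes U: "chain_subspace F U" and T: "chain_linear T"
  shows "chain_subspace F {x \<in> U. T x = (\<lambda>h. 0)}"
  using U T chain_linear_zero[OF T] by (auto simp: chain_subspace_def chain_linear_def)

lemma fdim_image_kernel:
  assumes U: "chain_subspace F U" and T: "chain_linear T" and F': "finite F'" "T ` U \<subseteq> supported F'"
  shows "fdim (T ` U) + fdim {x \<in> U. T x = (\<lambda>h. 0)} = fdim U"
proof -
  note W = chain_subspace_image[OF assms]
  interpret V: vectorspace class_ring "fun_module U" by (rule vectorspace_fun_module[OF U])
  interpret W: vectorspace class_ring "fun_module (T ` U)" by (rule vectorspace_fun_module[OF W])
  have "T \<in> LinearCombinations.module_hom class_ring (fun_module U) (fun_module (T ` U))"
    using T by (auto simp: LinearCombinations.module_hom_def chain_linear_def)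
  then interpret T: linear_map class_ring "fun_module U" "fun_module (T ` U)" T
    by (rule linear_mapI[OF V.vectorspace_axioms W.vectorspace_axioms])
  show ?thesis using T.rank_nullity_image[OF fin_dim_fun_module[OF U]] by simp
qed

lemma coset_fun_module: "N +>\<^bsub>fun_module U\<^esub> x = {(\<lambda>g. n g + x g) |n. n \<in> N}"
  by (auto simp: a_r_coset_def')

text \<open>
  Here \<open>e\<close> is the map \<open>U / N \<rightarrow> U' / N'\<close> induced by the inclusion of \<open>U\<close> in \<open>U'\<close>. After the projection of
  \<open>U\<close> onto \<open>U / N\<close> it becomes the projection modulo \<open>N'\<close>, restricted to \<open>U\<close>, whose kernel is \<open>U \<inter> N'\<close>. Both
  maps have the same image, so the rank of \<open>e\<close> is \<open>fdim U - fdim (U \<inter> N')\<close>. The set \<open>S\<close> is arbitrary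
  since a coset is formed with the addition alone.
\<close>

lemma induced_map_dims:
  fixes N N' U U' S :: "('g \<Rightarrow> 'f::field) set"
  assumes U: "chain_subspace F U" and U': "chain_subspace F U'"
    and N: "chain_subspace F N" and N': "chain_subspace F N'"
    and incl: "N \<subseteq> U" "N' \<subseteq> U'" "U \<subseteq> U'" "N \<subseteq> N'"
  defines "H \<equiv> quotient_space (fun_module U) N"
    and "H' \<equiv> quotient_space (fun_module U') N'"
    and "e \<equiv> \<lambda>X. \<Union>z\<in>X. N' +>\<^bsub>fun_module S\<^esub> z"
  shows "vectorspace.dim class_ring (H\<lparr>carrier := a_kernel H H' e\<rparr>) + fdim N = fdim (U \<inter> N')"
    and "vectorspace.dim class_ring (quotient_space H' (e ` carrier H)) + fdim N' + fdim U =
      fdim U' + fdim (U \<inter> N')"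
proof -
  let ?K = "class_ring :: 'f ring"
  let ?c = "\<lambda>x. N +>\<^bsub>fun_module U\<^esub> x" and ?c' = "\<lambda>x. N' +>\<^bsub>fun_module U'\<^esub> x"
  interpret U: vectorspace ?K "fun_module U" by (rule vectorspace_fun_module[OF U])
  interpret U': vectorspace ?K "fun_module U'" by (rule vectorspace_fun_module[OF U'])
  note sub = submodule_fun_module[OF U N incl(1)] and sub' = submodule_fun_module[OF U' N' incl(2)]
  note fin = fin_dim_fun_module[OF U] and fin' = fin_dim_fun_module[OF U']
  note H = U.quotient_space_dim[OF fin sub, folded H_def, unfolded fun_module_simps]
  note H' = U'.quotient_space_dim[OF fin' sub', folded H'_def, unfolded fun_module_simps]
  interpret c: linear_map ?K "fun_module U" H ?c
    unfolding H_def by (rule U.linear_map_quotient_space(1)[OF sub])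
  interpret c': linear_map ?K "fun_module U'" H' ?c'
    unfolding H'_def by (rule U'.linear_map_quotient_space(1)[OF sub'])
  have carrier_H: "carrier H = ?c ` U"
    using U.linear_map_quotient_space(2)[OF sub] by (simp add: H_def)
  have e_coset: "e (?c x) = ?c' x" if "x \<in> U" for x
  proof -
    have "N' +>\<^bsub>fun_module S\<^esub> z = ?c' x" if z: "z \<in> ?c x" for z
    proof -
      obtain n where n: "n \<in> N" "z = (\<lambda>g. n g + x g)" using z by (auto simp: coset_fun_module)
      have shift: "(\<lambda>g. m g + a * n g) \<in> N'" if "m \<in> N'" for m a
      proof -
        have "(\<lambda>g. a * n g) \<in> N'" using n(1) incl(4) N' by (auto simp: chain_subspace_def)
        then show ?thesis using that N' by (auto simp: chain_subspace_def)
      qed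
      show ?thesis
      proof (intro equalityI subsetI)
        fix y assume "y \<in> N' +>\<^bsub>fun_module S\<^esub> z"
        then obtain m where m: "m \<in> N'" "y = (\<lambda>g. m g + z g)" by (auto simp: coset_fun_module)
        then have "y = (\<lambda>g. (m g + 1 * n g) + x g)" by (simp add: n(2) add.assoc)
        with shift[OF m(1), of 1] show "y \<in> ?c' x"
          unfolding coset_fun_module by (intro CollectI exI[of _ "\<lambda>g. m g + 1 * n g"] conjI)
      next
        fix y assume "y \<in> ?c' x"
        then obtain m where m: "m \<in> N'" "y = (\<lambda>g. m g + x g)" by (auto simp: coset_fun_module)
        then have "y = (\<lambda>g. (m g + - 1 * n g) + z g)" by (simp add: n(2))
        with shift[OF m(1), of "- 1"] show "y \<in> N' +>\<^bsub>fun_module S\<^esub> z"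
          unfolding coset_fun_module by (intro CollectI exI[of _ "\<lambda>g. m g + - 1 * n g"] conjI)
      qed
    qed
    moreover have "x \<in> ?c x"
      using N by (auto simp: coset_fun_module chain_subspace_def intro!: exI[of _ "\<lambda>g. 0"])
    ultimately show ?thesis unfolding e_def by blast
  qed
  \<comment> \<open>On cosets \<open>e\<close> acts through representatives, so it inherits linearity from the two projections.\<close>
  have "e \<in> LinearCombinations.module_hom ?K H H'"
  proof -
    have "e X \<in> carrier H'" if X: "X \<in> carrier H" for X
    proof -
      obtain x where x: "x \<in> U" "X = ?c x" using X unfolding carrier_H by blast
      then have "x \<in> carrier (fun_module U')" using incl(3) by auto
      then show ?thesis using c'.f_im[of x] x e_coset[of x] by simp
    qed
    moreover have "e (X \<oplus>\<^bsub>H\<^esub> Y) = e X \<oplus>\<^bsub>H'\<^esub> e Y" if XY: "X \<in> carrier H" "Y \<in> carrier H" for X Y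
    proof -
      obtain x y where x: "x \<in> U" "X = ?c x" and y: "y \<in> U" "Y = ?c y"
        using XY unfolding carrier_H by blast
      have "x \<in> U'" "y \<in> U'" using x y incl(3) by auto
      moreover have "(\<lambda>g. x g + y g) \<in> U" using x y U by (auto simp: chain_subspace_def)
      moreover have "X \<oplus>\<^bsub>H\<^esub> Y = ?c (\<lambda>g. x g + y g)"
        using c.f_add[of x y] x y by simp
      ultimately show ?thesis
        using c'.f_add[of x y] x y e_coset[of x] e_coset[of y] e_coset[of "\<lambda>g. x g + y g"] by simp
    qed
    moreover have "e (a \<odot>\<^bsub>H\<^esub> X) = a \<odot>\<^bsub>H'\<^esub> e X" if X: "X \<in> carrier H" for a X
    proof -
      obtain x where x: "x \<in> U" "X = ?c x" using X unfolding carrier_H by blast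
      have "x \<in> U'" using x incl(3) by auto
      moreover have "(\<lambda>g. a * x g) \<in> U" using x U by (auto simp: chain_subspace_def)
      moreover have "a \<odot>\<^bsub>H\<^esub> X = ?c (\<lambda>g. a * x g)"
        using c.f_smult[of a x] x by simp
      ultimately show ?thesis
        using c'.f_smult[of a x] x e_coset[of x] e_coset[of "\<lambda>g. a * x g"] by simp
    qed
    ultimately show ?thesis by (auto simp: LinearCombinations.module_hom_def)
  qed
  then interpret e: linear_map ?K H H' e
    by (rule linear_mapI[OF c.W.vectorspace_axioms c'.W.vectorspace_axioms])
  have "?c' \<in> LinearCombinations.module_hom ?K (fun_module U) H'"
    unfolding LinearCombinations.module_hom_def
  proof (intro CollectI conjI allI impI Pi_I)
    fix x assume "x \<in> carrier (fun_module U)"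
    then have "x \<in> carrier (fun_module U')" using incl(3) by auto
    then show "?c' x \<in> carrier H'" by (rule c'.f_im)
  next
    fix x y assume "x \<in> carrier (fun_module U) \<and> y \<in> carrier (fun_module U)"
    then have "x \<in> carrier (fun_module U')" "y \<in> carrier (fun_module U')" using incl(3) by auto
    from c'.f_add[OF this] show "?c' (x \<oplus>\<^bsub>fun_module U\<^esub> y) = ?c' x \<oplus>\<^bsub>H'\<^esub> ?c' y" by simp
  next
    fix a x assume "a \<in> carrier ?K \<and> x \<in> carrier (fun_module U)"
    then have "a \<in> carrier ?K" "x \<in> carrier (fun_module U')" using incl(3) by auto
    from c'.f_smult[OF this] show "?c' (a \<odot>\<^bsub>fun_module U\<^esub> x) = a \<odot>\<^bsub>H'\<^esub> ?c' x" by simp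
  qed
  then interpret t: linear_map ?K "fun_module U" H' ?c'
    by (rule linear_mapI[OF U.vectorspace_axioms c'.W.vectorspace_axioms])
  define I where "I = e ` carrier H"
  have I: "I = ?c' ` U" by (auto simp: I_def carrier_H e_coset image_image)
  have ker_t: "{x \<in> U. ?c' x = \<zero>\<^bsub>H'\<^esub>} = U \<inter> N'"
    using U'.linear_map_quotient_space(3)[OF sub'] incl(3) by (auto simp: H'_def)
  have rank: "vectorspace.dim ?K (H'\<lparr>carrier := I\<rparr>) + fdim (U \<inter> N') = fdim U"
    using t.rank_nullity_image[OF fin] by (simp add: I ker_t)
  have "a_kernel H H' e = {X \<in> carrier H. e X = \<zero>\<^bsub>H'\<^esub>}"
    by (simp add: a_kernel_def')
  then have "vectorspace.dim ?K (H'\<lparr>carrier := I\<rparr>) +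
      vectorspace.dim ?K (H\<lparr>carrier := a_kernel H H' e\<rparr>) = vectorspace.dim ?K H"
    using e.rank_nullity_image[OF H(2)] by (simp add: I_def)
  with rank H(3) show "vectorspace.dim ?K (H\<lparr>carrier := a_kernel H H' e\<rparr>) + fdim N = fdim (U \<inter> N')"
    by simp
  have "submodule ?K I H'"
    using e.im_is_submodule by (simp add: e.im_def I_def)
  then have "vectorspace.dim ?K (quotient_space H' I) + vectorspace.dim ?K (H'\<lparr>carrier := I\<rparr>) =
      vectorspace.dim ?K H'"
    by (rule vectorspace.quotient_space_dim(3)[OF H'(1,2)])
  with rank H'(3) show "vectorspace.dim ?K (quotient_space H' (e ` carrier H)) + fdim N' + fdim U =
      fdim U' + fdim (U \<inter> N')"
    by (simp add: I_def)
qed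

section \<open>Homology and relative ranks\<close>

definition level :: "('f::field, 'g, 'z) bicomplex_scheme \<Rightarrow> real \<times> real \<Rightarrow> int \<Rightarrow> 'g set" where
  "level C p k = {g \<in> gens C. val C g = p \<and> int (gen_dim C g) = k}"

text \<open>
  The boundary map of the quotient of the complex at \<open>p\<close> by the complex strictly below \<open>p\<close>, whose
  \<open>k\<close>-chains are those supported on \<open>level C p k\<close>.
\<close>

definition relative_boundary ::
  "('f::field, 'g, 'z) bicomplex_scheme \<Rightarrow> real \<times> real \<Rightarrow> ('g \<Rightarrow> 'f) \<Rightarrow> 'g \<Rightarrow> 'f" where
  "relative_boundary C p c = (\<lambda>h. if val C h = p then boundary C c h else 0)"

abbreviation relative_rank :: "('f::field, 'g, 'z) bicomplex_scheme \<Rightarrow> real \<times> real \<Rightarrow> int \<Rightarrow> nat" where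
  "relative_rank C p k \<equiv> fdim (relative_boundary C p ` supported (level C p k))"

lemma chain_linear_boundary: "chain_linear (boundary C)"
  by (simp add: chain_linear_def boundary_def distrib_right sum.distrib sum_distrib_left mult.assoc)

lemma chain_linear_relative_boundary: "chain_linear (relative_boundary C p)"
  using chain_linear_boundary[of C] by (auto simp: chain_linear_def relative_boundary_def)

lemma strict_sublevel_eq: "strict_sublevel C p = {g \<in> gens C. val C g < p}"
  unfolding strict_sublevel_def sublevel_def by (auto intro: le_less_trans)

lemma chain_space_eq: "chain_space C S k = fun_module (supported {g \<in> S. int (gen_dim C g) = k})"
  by (simp add: chain_space_def fun_module_def supported_def)

lemma fdim_chain_space:
  "finite S \<Longrightarrow> vectorspace.dim class_ring (chain_space C S k) = card {g \<in> S. int (gen_dim C g) = k}"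
  by (simp add: chain_space_eq fin_dim_supported)

lemma card_sublevel_split:
  assumes "finite (gens C)"
  shows "card {g \<in> sublevel C p. int (gen_dim C g) = k} =
    card {g \<in> strict_sublevel C p. int (gen_dim C g) = k} + card (level C p k)"
proof -
  have "{g \<in> sublevel C p. int (gen_dim C g) = k} =
      {g \<in> strict_sublevel C p. int (gen_dim C g) = k} \<union> level C p k"
    by (auto simp: sublevel_def strict_sublevel_eq level_def order.order_iff_strict)
  then show ?thesis
    using assms by (subst card_Un_disjoint[symmetric]) (auto simp: strict_sublevel_eq level_def)
qed

lemma gamma_eq_card_level:
  assumes "finite (gens D)"
  shows "gamma D p k = int (card (level D p k))"
proof -
  have "finite (sublevel D p)" "finite (strict_sublevel D p)"
    using assms by (auto simp: sublevel_def strict_sublevel_eq)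
  then show ?thesis
    using card_sublevel_split[OF assms, of p k] by (simp add: gamma_def fdim_chain_space)
qed

context bifiltered_complex
begin

lemma boundary_nonzeroE:
  assumes "boundary C c h \<noteq> 0"
  obtains g where "g \<in> gens C" "c g \<noteq> 0" "bd C g h \<noteq> 0"
proof -
  obtain g where "g \<in> gens C" "c g * bd C g h \<noteq> 0"
    using assms unfolding boundary_def by (meson sum.neutral)
  then show ?thesis using that by auto
qed

lemma boundary_supported: "boundary C ` U \<subseteq> supported (gens C)"
  using bd_gens by (auto simp: supported_def elim!: boundary_nonzeroE)

lemma boundary_boundary: "boundary C (boundary C c) = (\<lambda>h. 0)"
proof
  fix h
  have "boundary C (boundary C c) h = (\<Sum>g\<in>gens C. \<Sum>g'\<in>gens C. c g * (bd C g g' * bd C g' h))"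
    unfolding boundary_def sum_distrib_right by (subst sum.swap) (simp add: mult.assoc)
  also have "\<dots> = (\<Sum>g\<in>gens C. c g * boundary C (bd C g) h)"
    by (simp add: boundary_def sum_distrib_left)
  finally show "boundary C (boundary C c) h = 0" by (simp add: boundary_bd)
qed

text \<open>
  Write \<open>A\<close> for the complex strictly below \<open>p\<close> and \<open>B\<close> for the complex at \<open>p\<close>. In every degree the
  kernel of \<open>eta\<close> is \<open>(Z(A) \<inter> D(B)) / D(A)\<close>, with \<open>Z\<close> for cycles and \<open>D\<close> for boundaries, and the rank of
  \<open>eta\<close> is \<open>dim Z(A) - dim (Z(A) \<inter> D(B))\<close>. The intersection \<open>Z(A) \<inter> D(B)\<close> is the image under the
  boundary of the relative cycles of the next degree, that is, of the kernel of the relative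
  boundary. Rank-nullity for the boundary on \<open>A\<close>, on \<open>B\<close> and on the relative cycles, and for the
  relative boundary, turns all dimensions into numbers of generators, dimensions of cycles and
  relative ranks. The dimensions of cycles cancel.
\<close>

theorem delta_relative_rank:
  "delta C p k + relative_rank C p k + relative_rank C p (k + 1) = card (level C p k)"
proof -
  define A where "A j = {g \<in> strict_sublevel C p. int (gen_dim C g) = j}" for j
  define B where "B j = {g \<in> sublevel C p. int (gen_dim C g) = j}" for j
  have A: "A j \<subseteq> gens C" and B: "B j \<subseteq> gens C" and AB: "A j \<subseteq> B j" for j
    by (auto simp: A_def B_def strict_sublevel_eq sublevel_def)
  note fin = finite_subset[OF _ finite_gens]
  have chains: "chain_subspace (gens C) (supported S)" if "S \<subseteq> gens C" for S
    using finite_gens that by (rule chain_subspace_supported)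
  let ?ZA = "cycles C (strict_sublevel C p)" and ?ZB = "cycles C (sublevel C p)"
  let ?BA = "boundaries C (strict_sublevel C p)" and ?BB = "boundaries C (sublevel C p)"
  have Z: "?ZA j = {c \<in> supported (A j). boundary C c = (\<lambda>h. 0)}"
    "?ZB j = {c \<in> supported (B j). boundary C c = (\<lambda>h. 0)}" for j
    by (auto simp: cycles_def chain_space_eq A_def B_def)
  have Bd: "?BA j = boundary C ` supported (A (j + 1))"
    "?BB j = boundary C ` supported (B (j + 1))" for j
    by (auto simp: boundaries_def chain_space_eq A_def B_def)
  have boundary_A: "boundary C ` supported (A (j + 1)) \<subseteq> supported (A j)"
    and boundary_B: "boundary C ` supported (B (j + 1)) \<subseteq> supported (B j)" for j
    using bd_gens bd_gen_dim bd_val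
    by (fastforce simp: supported_def A_def B_def strict_sublevel_eq sublevel_def
        elim!: boundary_nonzeroE intro: le_less_trans order.trans)+
  have mono: "supported S \<subseteq> supported S'" if "S \<subseteq> S'" for S S' :: "'g set"
    using that by (auto simp: supported_def)
  have subspaces: "chain_subspace (gens C) (?ZA j)" "chain_subspace (gens C) (?ZB j)"
    "chain_subspace (gens C) (?BA j)" "chain_subspace (gens C) (?BB j)" for j
    unfolding Z Bd
    by (rule chain_subspace_kernel[OF chains[OF A] chain_linear_boundary]
        chain_subspace_kernel[OF chains[OF B] chain_linear_boundary]
        chain_subspace_image[OF chains[OF A] chain_linear_boundary finite_gens boundary_supported]
        chain_subspace_image[OF chains[OF B] chain_linear_boundary finite_gens boundary_supported])+
  have incl: "?BA j \<subseteq> ?ZA j" "?BB j \<subseteq> ?ZB j" "?ZA j \<subseteq> ?ZB j" "?BA j \<subseteq> ?BB j" for j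
    using boundary_A[of j] boundary_B[of j] mono[OF AB[of j]] mono[OF AB[of "j + 1"]]
    by (auto simp: Z Bd boundary_boundary)
  define m where "m j = fdim (?ZA j \<inter> ?BB j)" for j
  have homology: "homology C (strict_sublevel C p) j = quotient_space (fun_module (?ZA j)) (?BA j)"
    "homology C (sublevel C p) j = quotient_space (fun_module (?ZB j)) (?BB j)" for j
    by (simp_all add: homology_def chain_space_eq)
  have eta: "eta C p j = (\<lambda>X. \<Union>z\<in>X. ?BB j +>\<^bsub>fun_module (supported (B j))\<^esub> z)" for j
    by (simp add: fun_eq_iff eta_def chain_space_eq B_def)
  have kernel: "vectorspace.dim class_ring (eta_kernel C p j) + fdim (?BA j) = m j" for j
    unfolding eta_kernel_def Let_def homology eta m_def
    by (rule induced_map_dims[OF subspaces incl])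
  have cokernel: "vectorspace.dim class_ring (eta_cokernel C p j) + fdim (?BB j) + fdim (?ZA j) =
      fdim (?ZB j) + m j" for j
    unfolding eta_cokernel_def homology eta m_def
    by (rule induced_map_dims[OF subspaces incl])
  have rank: "fdim (?BA j) + fdim (?ZA (j + 1)) = card (A (j + 1))"
    "fdim (?BB j) + fdim (?ZB (j + 1)) = card (B (j + 1))" for j
    using fdim_image_kernel[OF chains[OF A] chain_linear_boundary finite_gens boundary_supported]
      fdim_image_kernel[OF chains[OF B] chain_linear_boundary finite_gens boundary_supported]
    by (simp_all add: Z Bd fin_dim_supported(2)[OF fin[OF A]] fin_dim_supported(2)[OF fin[OF B]])
  \<comment> \<open>The relative cycles: chains at \<open>p\<close> whose boundary lies strictly below \<open>p\<close>.\<close>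
  define R where "R j = {c \<in> supported (B j). relative_boundary C p c = (\<lambda>h. 0)}" for j
  have R_subspace: "chain_subspace (gens C) (R j)" for j
    unfolding R_def by (intro chain_subspace_kernel chains B chain_linear_relative_boundary)
  have R_iff: "c \<in> R (j + 1) \<longleftrightarrow> c \<in> supported (B (j + 1)) \<and> boundary C c \<in> supported (A j)" for c j
  proof -
    have "relative_boundary C p c = (\<lambda>h. 0) \<longleftrightarrow> boundary C c \<in> supported (A j)"
      if "c \<in> supported (B (j + 1))"
    proof -
      have "boundary C c \<in> supported (B j)" using boundary_B that by blast
      then show ?thesis
        by (auto simp: relative_boundary_def fun_eq_iff supported_def A_def B_def
            strict_sublevel_eq sublevel_def order.order_iff_strict split: if_splits)
    qed
    then show ?thesis by (auto simp: R_def)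
  qed
  have "?ZA j \<inter> ?BB j = boundary C ` R (j + 1)" for j
    by (auto simp: R_iff Z Bd boundary_boundary)
  moreover have "{c \<in> R (j + 1). boundary C c = (\<lambda>h. 0)} = ?ZB (j + 1)" for j
    by (auto simp: R_def Z relative_boundary_def)
  moreover have "fdim (boundary C ` R (j + 1)) + fdim {c \<in> R (j + 1). boundary C c = (\<lambda>h. 0)} =
      fdim (R (j + 1))" for j
    by (rule fdim_image_kernel[OF R_subspace chain_linear_boundary finite_gens boundary_supported])
  ultimately have m: "m j + fdim (?ZB (j + 1)) = fdim (R (j + 1))" for j
    by (simp add: m_def)
  have "relative_boundary C p ` supported (B j) = relative_boundary C p ` supported (level C p j)" for j
  proof (rule equalityI, rule subsetI)
    fix x assume "x \<in> relative_boundary C p ` supported (B j)"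
    then obtain c where c: "c \<in> supported (B j)" "x = relative_boundary C p c" by blast
    \<comment> \<open>The part of \<open>c\<close> of value below \<open>p\<close> has a boundary without entries of value \<open>p\<close>.\<close>
    define c' where "c' g = (if val C g = p then c g else 0)" for g
    have "c' \<in> supported (level C p j)"
      using c(1) by (auto simp: c'_def supported_def B_def level_def sublevel_def)
    moreover have "c g * bd C g h = c' g * bd C g h" if "g \<in> gens C" "val C h = p" for g h
    proof (cases "c g = 0 \<or> bd C g h = 0")
      case False
      then have "val C g \<le> p" "val C h \<le> val C g"
        using c(1) bd_val that(1) by (auto simp: supported_def B_def sublevel_def)
      then show ?thesis using that(2) by (simp add: c'_def)
    qed (auto simp: c'_def)
    then have "x = relative_boundary C p c'"
      by (auto simp: c(2) relative_boundary_def boundary_def fun_eq_iff intro!: sum.cong)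
    ultimately show "x \<in> relative_boundary C p ` supported (level C p j)" by blast
  qed (intro image_mono mono, auto simp: level_def B_def sublevel_def)
  moreover have "fdim (relative_boundary C p ` supported (B j)) + fdim (R j) = fdim (supported (B j) :: ('g \<Rightarrow> 'f) set)" for j
    unfolding R_def
    by (intro fdim_image_kernel[OF chains[OF B] chain_linear_relative_boundary finite_gens])
      (use bd_gens in \<open>auto simp: relative_boundary_def supported_def split: if_splits elim!: boundary_nonzeroE\<close>)
  ultimately have R: "relative_rank C p j + fdim (R j) = card (B j)" for j
    using fin_dim_supported(2)[OF fin[OF B], of j] by simp
  have "card (B k) = card (A k) + card (level C p k)"
    using card_sublevel_split[OF finite_gens] by (simp add: A_def B_def)
  with kernel[of "k - 1"] cokernel[of k] rank(1)[of "k - 1"] rank(2)[of k] m[of "k - 1"] m[of k]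
    R[of k] R[of "k + 1"]
  show ?thesis unfolding delta_def by simp
qed

end

section \<open>Invariant of the local reduction\<close>

lemma arg_max_on_finite:
  fixes f :: "'a \<Rightarrow> 'b::linorder"
  assumes "finite S" "S \<noteq> {}"
  shows "arg_max_on f S \<in> S" and "x \<in> S \<Longrightarrow> f x \<le> f (arg_max_on f S)"
proof -
  have "Max (f ` S) \<in> f ` S" using assms by simp
  then obtain y where "y \<in> S" "f y = Max (f ` S)" by auto
  then have "is_arg_max f (\<lambda>x. x \<in> S) y" using assms by (simp add: is_arg_max_linorder)
  then have "is_arg_max f (\<lambda>x. x \<in> S) (arg_max_on f S)"
    unfolding arg_max_on_def arg_max_def by (rule someI)
  then show "arg_max_on f S \<in> S" "x \<in> S \<Longrightarrow> f x \<le> f (arg_max_on f S)"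
    by (simp_all add: is_arg_max_linorder)
qed

lemma (in linorder) sorted_key_list_of_set_inj_on:
  assumes "inj_on f A" "finite A"
  shows "set (sorted_key_list_of_set f A) = A"
    and "sorted_wrt (<) (map f (sorted_key_list_of_set f A))"
proof -
  interpret folding_insort_key "(\<le>)" "(<)" A f
    by (intro folding_insort_key.intro folding_insort_key_axioms.intro linorder_axioms assms(1))
  show "set (sorted_key_list_of_set f A) = A"
    "sorted_wrt (<) (map f (sorted_key_list_of_set f A))"
    using assms(2) by simp_all
qed

definition labelled ::
  "('f::field, 'g, 'z) bicomplex_scheme \<Rightarrow> ('f, 'g) chunk_state \<Rightarrow> label \<Rightarrow> real \<times> real \<Rightarrow> int \<Rightarrow> 'g set" where
  "labelled C s l p k = {g \<in> level C p k. lab s g = l}"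

text \<open>
  What the local reduction guarantees of the column \<open>x\<close> made from \<open>c\<close>. The first part says that
  \<open>x\<close> is the boundary of a chain of generators with the value and dimension of \<open>c\<close>: so it is a cycle
  with entries of value at most that of \<open>c\<close>. The second part records how \<open>x\<close> arose from \<open>bd C c\<close>, in
  terms of the final form of the columns that were added.
\<close>

definition derived_column ::
  "('f::field, 'g, 'z) bicomplex_scheme \<Rightarrow> ('f, 'g) chunk_state \<Rightarrow> 'g \<Rightarrow> ('g \<Rightarrow> 'f) \<Rightarrow> bool" where
  "derived_column C s c x \<longleftrightarrow>
    (\<exists>u\<in>supported (level C (val C c) (int (gen_dim C c))). x = boundary C u) \<and>
    (\<exists>a\<in>supported (labelled C s LocalNegative (val C c) (int (gen_dim C c))).
      x = (\<lambda>h. bd C c h + (\<Sum>g\<in>gens C. a g * stored s g h)))"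

locale chunk_input = bifiltered_complex C
  for C :: "('f::field, 'g) bicomplex" +
  fixes i :: "'g \<Rightarrow> 'i::linorder"
  assumes index: "index_function C i"
begin

lemma inj_index: "inj_on i (gens C)"
  using index by (simp add: index_function_def)

lemma local_pivot_None_iff:
  "local_pivot C i c x = None \<longleftrightarrow> (\<forall>h\<in>gens C. val C h = val C c \<longrightarrow> x h = 0)"
  by (auto simp: local_pivot_def Let_def)

lemma local_pivot_SomeD:
  assumes "local_pivot C i c x = Some h"
  shows "h \<in> gens C" "x h \<noteq> 0" "val C h = val C c"
    and "\<And>h'. h' \<in> gens C \<Longrightarrow> x h' \<noteq> 0 \<Longrightarrow> val C h' = val C c \<Longrightarrow> i h' \<le> i h"
proof -
  let ?L = "{h \<in> gens C. x h \<noteq> 0 \<and> val C h = val C c}"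
  have L: "finite ?L" "?L \<noteq> {}" "h = arg_max_on i ?L"
    using assms finite_gens by (auto simp: local_pivot_def Let_def split: if_splits)
  note max = arg_max_on_finite[where f = i, OF L(1,2), folded L(3)]
  show "h \<in> gens C" "x h \<noteq> 0" "val C h = val C c" using max(1) by auto
  show "i h' \<le> i h" if "h' \<in> gens C" "x h' \<noteq> 0" "val C h' = val C c" for h'
    using max(2)[of h'] that by auto
qed

lemma boundary_levelD:
  assumes "u \<in> supported (level C p k)" "boundary C u h \<noteq> 0"
  shows "h \<in> gens C" "val C h \<le> p" "k = int (gen_dim C h) + 1"
proof -
  obtain g where g: "g \<in> gens C" "u g \<noteq> 0" "bd C g h \<noteq> 0"
    using assms(2) by (rule boundary_nonzeroE)
  then have "val C g = p" "int (gen_dim C g) = k"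
    using assms(1) by (auto simp: supported_def level_def)
  then show "h \<in> gens C" "val C h \<le> p" "k = int (gen_dim C h) + 1"
    using bd_gens[OF g(1,3)] bd_val[OF g(1,3)] bd_gen_dim[OF g(1,3)] by auto
qed

lemma derived_column_bd:
  assumes "c \<in> gens C"
  shows "derived_column C s c (bd C c)"
proof -
  let ?u = "\<lambda>g. if g = c then 1 else 0"
  have "?u \<in> supported (level C (val C c) (int (gen_dim C c)))"
    using assms by (auto simp: supported_def level_def)
  moreover have "bd C c = boundary C ?u"
    using assms finite_gens by (auto simp: boundary_def fun_eq_iff if_distrib[of "\<lambda>y. y * _"] cong: if_cong)
  moreover have "(\<lambda>g. 0) \<in> supported (labelled C s LocalNegative (val C c) (int (gen_dim C c)))"
    by (simp add: supported_def)
  ultimately show ?thesis unfolding derived_column_def by (intro conjI bexI) auto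
qed

lemma derived_column_add:
  assumes c: "c \<in> gens C" and x: "derived_column C s c x"
    and g: "g \<in> labelled C s LocalNegative (val C c) (int (gen_dim C c))"
    and stored_g: "derived_column C s g (stored s g)"
  shows "derived_column C s c (\<lambda>h. x h + t * stored s g h)"
proof -
  let ?p = "val C c" and ?k = "int (gen_dim C c)"
  have g': "g \<in> gens C" "val C g = ?p" "int (gen_dim C g) = ?k"
    using g by (auto simp: labelled_def level_def)
  obtain u a where u: "u \<in> supported (level C ?p ?k)" "x = boundary C u"
    and a: "a \<in> supported (labelled C s LocalNegative ?p ?k)"
      "x = (\<lambda>h. bd C c h + (\<Sum>g\<in>gens C. a g * stored s g h))"
    using x by (auto simp: derived_column_def)
  obtain v where v: "v \<in> supported (level C ?p ?k)" "stored s g = boundary C v"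
    using stored_g g' by (auto simp: derived_column_def)
  have "(\<lambda>h. u h + t * v h) \<in> supported (level C ?p ?k)"
    using u(1) v(1) by (rule supported_add_smult)
  moreover have "(\<lambda>h. x h + t * stored s g h) = boundary C (\<lambda>h. u h + t * v h)"
    unfolding u(2) v(2) by (simp add: boundary_def distrib_right sum.distrib sum_distrib_left mult.assoc)
  moreover have "(\<lambda>h. a h + (if h = g then t else 0)) \<in> supported (labelled C s LocalNegative ?p ?k)"
    using a(1) g by (auto simp: supported_def)
  moreover have "(\<lambda>h. x h + t * stored s g h) =
      (\<lambda>h. bd C c h + (\<Sum>g'\<in>gens C. (a g' + (if g' = g then t else 0)) * stored s g' h))"
    using finite_gens g'(1)
    by (simp add: a(2) distrib_right sum.distrib if_distrib[of "\<lambda>y. y * _"] add.assoc cong: if_cong)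
  ultimately show ?thesis
    unfolding derived_column_def
    by (intro conjI bexI[of _ "\<lambda>h. u h + t * v h"] bexI[of _ "\<lambda>h. a h + (if h = g then t else 0)"])
qed

text \<open>
  Later steps only create further local negative columns and leave the existing ones as they are.
\<close>

lemma derived_column_mono:
  assumes "derived_column C s c x"
    and "\<And>g. g \<in> gens C \<Longrightarrow> lab s g = LocalNegative \<Longrightarrow> lab s' g = LocalNegative \<and> stored s' g = stored s g"
  shows "derived_column C s' c x"
proof -
  obtain a where a: "a \<in> supported (labelled C s LocalNegative (val C c) (int (gen_dim C c)))"
    "x = (\<lambda>h. bd C c h + (\<Sum>g\<in>gens C. a g * stored s g h))"
    using assms(1) by (auto simp: derived_column_def)
  have "a \<in> supported (labelled C s' LocalNegative (val C c) (int (gen_dim C c)))"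
    using a(1) assms(2) by (auto simp: supported_def labelled_def level_def)
  moreover have "a g * stored s g h = a g * stored s' g h" if "g \<in> gens C" for g h
    using a(1) assms(2)[OF that] by (cases "a g = 0") (auto simp: supported_def labelled_def)
  then have "x = (\<lambda>h. bd C c h + (\<Sum>g\<in>gens C. a g * stored s' g h))"
    by (auto simp: a(2) fun_eq_iff intro!: sum.cong)
  ultimately show ?thesis using assms(1) unfolding derived_column_def by blast
qed

text \<open>
  An addition cancels the local pivot and changes, among the entries with the value of \<open>c\<close>, only those
  of index at most that of the pivot. So the index of the local pivot decreases, or the pivot
  disappears; the number of generators up to this index measures the progress.
\<close>

lemma reduce_column_correct:
  assumes c: "c \<in> gens C" "stored s c = bd C c"
    and neg: "\<And>g. g \<in> gens C \<Longrightarrow> lab s g = LocalNegative \<Longrightarrow> derived_column C s g (stored s g)"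
  shows "derived_column C s c (reduce_column C i s c)"
    and "reducers C i s c (reduce_column C i s c) = {}"
proof -
  define heads where "heads x = {g \<in> gens C. \<exists>h\<in>gens C. x h \<noteq> 0 \<and> val C h = val C c \<and> i g \<le> i h}"
    for x :: "'g \<Rightarrow> 'f"
  let ?next = "\<lambda>x. eliminate x (stored s (SOME c'. c' \<in> reducers C i s c x)) (the (local_pivot C i c x))"
  have step: "derived_column C s c (?next x) \<and> card (heads (?next x)) < card (heads x)"
    if x: "derived_column C s c x" and nonempty: "reducers C i s c x \<noteq> {}" for x
  proof -
    define c' where "c' = (SOME c'. c' \<in> reducers C i s c x)"
    have "c' \<in> reducers C i s c x" unfolding c'_def using nonempty by (rule some_in_eq[THEN iffD2])
    then obtain h where c': "c' \<in> gens C" "gen_dim C c' = gen_dim C c" "lab s c' = LocalNegative"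
      and pivot: "local_pivot C i c x = Some h" and pivot': "local_pivot C i c' (stored s c') = Some h"
      by (auto simp: reducers_def columns_def)
    note h = local_pivot_SomeD[OF pivot] and h' = local_pivot_SomeD[OF pivot']
    have val: "val C c' = val C c" using h(3) h'(3) by simp
    define t where "t = - (x h / stored s c' h)"
    have next_eq: "?next x = (\<lambda>g. x g + t * stored s c' g)"
      by (simp add: eliminate_def pivot t_def c'_def)
    have "derived_column C s c (?next x)"
      unfolding next_eq using c' val neg
      by (intro derived_column_add[OF c(1) x]) (auto simp: labelled_def level_def)
    moreover have "heads (?next x) \<subseteq> {g \<in> gens C. i g < i h}"
    proof
      fix g assume "g \<in> heads (?next x)"
      then obtain g' where g: "g \<in> gens C" "i g \<le> i g'"
        and g': "g' \<in> gens C" "x g' + t * stored s c' g' \<noteq> 0" "val C g' = val C c"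
        by (auto simp: heads_def next_eq)
      have "g' \<noteq> h" using g'(2) h'(2) by (auto simp: t_def)
      moreover have "i g' \<le> i h" using g' h(4) h'(4) val by (cases "x g' = 0") auto
      ultimately have "i g' < i h"
        using inj_index g'(1) h(1) by (auto simp: inj_on_def order.order_iff_strict)
      with g show "g \<in> {g \<in> gens C. i g < i h}" by auto
    qed
    moreover have "{g \<in> gens C. i g < i h} \<subset> heads x"
      using h(1-3) by (auto simp: heads_def intro: less_imp_le)
    moreover have "finite (heads x)" using finite_gens by (simp add: heads_def)
    ultimately show ?thesis by (meson order.strict_trans1 psubset_card_mono)
  qed
  have "derived_column C s c (reduce_column C i s c) \<and> reducers C i s c (reduce_column C i s c) = {}"
    unfolding reduce_column_def
  proof (rule while_rule[where P = "derived_column C s c" and r = "measure (\<lambda>x. card (heads x))"])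
    show "derived_column C s c (stored s c)" using derived_column_bd[OF c(1)] c(2) by simp
  qed (use step in auto)
  then show "derived_column C s c (reduce_column C i s c)" "reducers C i s c (reduce_column C i s c) = {}"
    by auto
qed

text \<open>
  The state after the columns in \<open>D\<close> have been traversed. The last three parts say that the local
  pivot is a bijection from the local negative columns onto the local positive ones.
\<close>

definition phase1_inv :: "'g set \<Rightarrow> ('f, 'g) chunk_state \<Rightarrow> bool" where
  "phase1_inv D s \<longleftrightarrow>
    (\<forall>g\<in>gens C. derived_column C s g (stored s g)) \<and>
    (\<forall>g\<in>D. lab s g \<noteq> Unlabeled) \<and>
    (\<forall>g\<in>gens C - D. lab s g \<in> {Unlabeled, LocalPositive} \<and> stored s g = bd C g) \<and>
    (\<forall>g\<in>gens C. lab s g = Global \<longrightarrow> local_pivot C i g (stored s g) = None) \<and>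
    (\<forall>g\<in>gens C. lab s g = LocalNegative \<longrightarrow>
      (\<exists>h. local_pivot C i g (stored s g) = Some h \<and> lab s h = LocalPositive)) \<and>
    (\<forall>h\<in>gens C. lab s h = LocalPositive \<longrightarrow>
      (\<exists>g\<in>gens C. lab s g = LocalNegative \<and> local_pivot C i g (stored s g) = Some h)) \<and>
    (\<forall>g\<in>gens C. \<forall>g'\<in>gens C. lab s g = LocalNegative \<longrightarrow> lab s g' = LocalNegative \<longrightarrow>
      local_pivot C i g (stored s g) = local_pivot C i g' (stored s g') \<longrightarrow> g = g')"

text \<open>
  So a local negative column can compete for a pivot only with columns of its own dimension.
\<close>

lemma pivot_dim:
  assumes "derived_column C s g x" "local_pivot C i g x = Some h"
  shows "gen_dim C g = Suc (gen_dim C h)"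
proof -
  obtain u where "u \<in> supported (level C (val C g) (int (gen_dim C g)))" "x = boundary C u"
    using assms(1) by (auto simp: derived_column_def)
  then show ?thesis using boundary_levelD(3) local_pivot_SomeD(2)[OF assms(2)] by fastforce
qed

text \<open>
  The decisive case is a column \<open>c\<close> that ends with a local pivot \<open>h\<close>. If \<open>h\<close> were already the pivot of
  a local negative column, that column would have the dimension of \<open>c\<close> and a smaller index, so the
  reduction of \<open>c\<close> would have continued. Hence \<open>h\<close> is a fresh pivot, and it is still unlabelled since
  lower dimensions are traversed later.
\<close>

lemma phase1_inv_process_column:
  assumes inv: "phase1_inv D s" and c: "c \<in> gens C - D"
    and earlier: "\<And>g. g \<in> D \<Longrightarrow> gen_dim C c < gen_dim C g \<or> gen_dim C c = gen_dim C g \<and> i g < i c"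
  shows "phase1_inv (insert c D) (process_column C i c s)"
proof (cases "lab s c = Unlabeled")
  case False
  then have "process_column C i c s = s" by (simp add: process_column_def)
  then show ?thesis using inv False by (auto simp: phase1_inv_def)
next
  case unlabeled: True
  have reduced: "\<And>g. g \<in> gens C \<Longrightarrow> derived_column C s g (stored s g)"
    and labels: "\<And>g. g \<in> D \<Longrightarrow> lab s g \<noteq> Unlabeled"
    and todo: "\<And>g. g \<in> gens C - D \<Longrightarrow> lab s g \<in> {Unlabeled, LocalPositive} \<and> stored s g = bd C g"
    and global: "\<And>g. g \<in> gens C \<Longrightarrow> lab s g = Global \<Longrightarrow> local_pivot C i g (stored s g) = None"
    and negative: "\<And>g. g \<in> gens C \<Longrightarrow> lab s g = LocalNegative \<Longrightarrow>
      \<exists>h. local_pivot C i g (stored s g) = Some h \<and> lab s h = LocalPositive"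
    and positive: "\<And>h. h \<in> gens C \<Longrightarrow> lab s h = LocalPositive \<Longrightarrow>
      \<exists>g\<in>gens C. lab s g = LocalNegative \<and> local_pivot C i g (stored s g) = Some h"
    and inj: "\<And>g g'. g \<in> gens C \<Longrightarrow> g' \<in> gens C \<Longrightarrow> lab s g = LocalNegative \<Longrightarrow>
      lab s g' = LocalNegative \<Longrightarrow>
      local_pivot C i g (stored s g) = local_pivot C i g' (stored s g') \<Longrightarrow> g = g'"
    using inv unfolding phase1_inv_def by blast+
  define x where "x = reduce_column C i s c"
  have c_gen: "c \<in> gens C" and c_stored: "stored s c = bd C c" using c todo by auto
  note x = reduce_column_correct[OF c_gen c_stored reduced, folded x_def]
  show ?thesis
  proof (cases "local_pivot C i c x")
    case None
    define s' where "s' = \<lparr>stored = (stored s)(c := x), lab = (lab s)(c := Global)\<rparr>"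
    have "process_column C i c s = s'"
      using unlabeled None by (simp add: process_column_def Let_def x_def s'_def)
    moreover have "derived_column C s' g y" if "derived_column C s g y" for g y
      using that by (rule derived_column_mono) (use unlabeled in \<open>auto simp: s'_def\<close>)
    then have "\<forall>g\<in>gens C. derived_column C s' g (stored s' g)"
      using reduced x(1) by (auto simp: s'_def)
    moreover have "lab s' g = LocalNegative \<longleftrightarrow> lab s g = LocalNegative"
      and "lab s' g = LocalPositive \<longleftrightarrow> lab s g = LocalPositive"
      and "lab s g = LocalNegative \<Longrightarrow> stored s' g = stored s g" for g
      using unlabeled by (auto simp: s'_def)
    moreover have "local_pivot C i g (stored s' g) = None" if "g \<in> gens C" "lab s' g = Global" for g
      using global[of g] None that by (auto simp: s'_def split: if_splits)
    moreover have "\<forall>g\<in>insert c D. lab s' g \<noteq> Unlabeled"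
      and "\<forall>g\<in>gens C - insert c D. lab s' g \<in> {Unlabeled, LocalPositive} \<and> stored s' g = bd C g"
      using labels todo by (auto simp: s'_def)
    ultimately show ?thesis
      using negative positive inj unfolding phase1_inv_def by (simp cong: conj_cong)
  next
    case (Some h)
    note h = local_pivot_SomeD[OF Some]
    have dim_h: "gen_dim C c = Suc (gen_dim C h)" by (rule pivot_dim[OF x(1) Some])
    then have "h \<noteq> c" "h \<notin> D" using earlier[of h] by auto
    have h_unlabeled: "lab s h = Unlabeled"
    proof (rule ccontr)
      assume "lab s h \<noteq> Unlabeled"
      then have "lab s h = LocalPositive" using todo[of h] h(1) \<open>h \<notin> D\<close> by auto
      then obtain g where g: "g \<in> gens C" "lab s g = LocalNegative" "local_pivot C i g (stored s g) = Some h"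
        using positive[OF h(1)] by auto
      have "g \<in> D" using todo[of g] g(1,2) by auto
      moreover have "gen_dim C g = gen_dim C c" using pivot_dim[OF reduced[OF g(1)] g(3)] dim_h by simp
      ultimately have "g \<in> reducers C i s c x"
        using g Some earlier[of g] by (auto simp: reducers_def columns_def)
      with x(2) show False by auto
    qed
    define s' where "s' = \<lparr>stored = (stored s)(c := x), lab = (lab s)(c := LocalNegative, h := LocalPositive)\<rparr>"
    have s'_eq: "process_column C i c s = s'"
      using unlabeled Some by (simp add: process_column_def Let_def x_def s'_def)
    have "derived_column C s' g y" if "derived_column C s g y" for g y
      using that by (rule derived_column_mono) (use unlabeled h_unlabeled in \<open>auto simp: s'_def\<close>)
    then have reduced': "derived_column C s' g (stored s' g)" if "g \<in> gens C" for g
      using reduced x(1) that by (auto simp: s'_def)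
    have old: "lab s' g = lab s g" "stored s' g = stored s g" if "g \<noteq> c" "g \<noteq> h" for g
      using that by (auto simp: s'_def)
    have new: "lab s' c = LocalNegative" "lab s' h = LocalPositive" "stored s' c = x" "stored s' h = stored s h"
      using \<open>h \<noteq> c\<close> by (auto simp: s'_def)
    have neg_iff: "lab s' g = LocalNegative \<longleftrightarrow> g = c \<or> g \<noteq> h \<and> lab s g = LocalNegative" for g
      using old new \<open>h \<noteq> c\<close> by (cases "g = c \<or> g = h") auto
    \<comment> \<open>The pivots of the earlier local negative columns carry a label.\<close>
    have fresh: "local_pivot C i g (stored s g) \<noteq> Some h" if "g \<in> gens C" "lab s g = LocalNegative" for g
      using negative[OF that] h_unlabeled by auto
    show ?thesis unfolding s'_eq phase1_inv_def
    proof (intro conjI ballI impI)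
      fix g assume g: "g \<in> gens C" "lab s' g = LocalNegative"
      show "\<exists>h. local_pivot C i g (stored s' g) = Some h \<and> lab s' h = LocalPositive"
      proof (cases "g = c")
        case False
        then have "lab s g = LocalNegative" "g \<noteq> h" using g(2) neg_iff by auto
        then obtain h' where "local_pivot C i g (stored s g) = Some h'" "lab s h' = LocalPositive"
          using negative[OF g(1)] by auto
        moreover from this have "lab s' h' = LocalPositive" using unlabeled by (auto simp: s'_def)
        ultimately show ?thesis using old False \<open>g \<noteq> h\<close> by auto
      qed (use Some new in auto)
    next
      fix h' assume h': "h' \<in> gens C" "lab s' h' = LocalPositive"
      show "\<exists>g\<in>gens C. lab s' g = LocalNegative \<and> local_pivot C i g (stored s' g) = Some h'"
      proof (cases "h' = h")
        case False
        then have "lab s h' = LocalPositive" using h'(2) by (auto simp: s'_def split: if_splits)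
        then obtain g where "g \<in> gens C" "lab s g = LocalNegative" "local_pivot C i g (stored s g) = Some h'"
          using positive[OF h'(1)] by auto
        moreover from this have "g \<noteq> c" "g \<noteq> h" using unlabeled h_unlabeled by auto
        ultimately show ?thesis using old by (intro bexI[of _ g]) auto
      qed (use Some new c_gen in auto)
    next
      fix g g' assume g: "g \<in> gens C" "g' \<in> gens C" "lab s' g = LocalNegative" "lab s' g' = LocalNegative"
        and eq: "local_pivot C i g (stored s' g) = local_pivot C i g' (stored s' g')"
      show "g = g'"
        using g eq neg_iff[of g] neg_iff[of g'] old[of g] old[of g'] new Some
          fresh[OF g(1)] fresh[OF g(2)] inj[OF g(1,2)]
        by (cases "g = c"; cases "g' = c") auto
    next
      fix g assume "g \<in> gens C" "lab s' g = Global"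
      then show "local_pivot C i g (stored s' g) = None"
        using global[of g] new old[of g] by (cases "g = c \<or> g = h") auto
    qed (use reduced' labels todo \<open>h \<noteq> c\<close> \<open>h \<notin> D\<close> in \<open>auto simp: s'_def\<close>)
  qed
qed

lemma phase1_inv_fold:
  assumes "phase1_inv D s" "set xs \<subseteq> gens C - D" "sorted_wrt (<) (map i xs)"
    and "\<forall>x\<in>set xs. gen_dim C x = n" "\<forall>g\<in>D. n < gen_dim C g \<or> n = gen_dim C g \<and> (\<forall>x\<in>set xs. i g < i x)"
  shows "phase1_inv (D \<union> set xs) (fold (process_column C i) xs s)"
  using assms
proof (induction xs arbitrary: D s)
  case (Cons x xs)
  have "phase1_inv (insert x D) (process_column C i x s)"
    using Cons.prems by (intro phase1_inv_process_column) auto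
  then have "phase1_inv (insert x D \<union> set xs) (fold (process_column C i) xs (process_column C i x s))"
    using Cons.prems by (intro Cons.IH) auto
  then show ?case by simp
qed simp

lemma phase1_inv_fold_dims:
  assumes "phase1_inv {g \<in> gens C. n \<le> gen_dim C g} s"
  shows "phase1_inv (gens C)
    (fold (\<lambda>k. fold (process_column C i) (sorted_key_list_of_set i (columns C k))) (rev [0..<n]) s)"
  using assms
proof (induction n arbitrary: s)
  case (Suc n)
  let ?xs = "sorted_key_list_of_set i (columns C n)"
  have "columns C n \<subseteq> gens C" by (auto simp: columns_def)
  then have "inj_on i (columns C n)" "finite (columns C n)"
    using inj_index finite_gens by (auto intro: inj_on_subset finite_subset)
  note set = sorted_key_list_of_set_inj_on(1)[OF this] and sorted = sorted_key_list_of_set_inj_on(2)[OF this]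
  have "{g \<in> gens C. Suc n \<le> gen_dim C g} \<union> set ?xs = {g \<in> gens C. n \<le> gen_dim C g}"
    unfolding set by (auto simp: columns_def)
  moreover have "phase1_inv ({g \<in> gens C. Suc n \<le> gen_dim C g} \<union> set ?xs) (fold (process_column C i) ?xs s)"
    using Suc.prems sorted by (intro phase1_inv_fold[where n = n]) (use set in \<open>auto simp: columns_def\<close>)
  ultimately show ?case using Suc.IH by simp
qed simp

lemma phase1_inv_phase1: "phase1_inv (gens C) (phase1 C i)"
proof -
  let ?s = "\<lparr>stored = bd C, lab = \<lambda>g. Unlabeled\<rparr>"
  have empty: "{g \<in> gens C. Suc (top_dim C) \<le> gen_dim C g} = {}"
    using gen_dim_le by fastforce
  have "phase1_inv {} ?s"
    using derived_column_bd by (simp add: phase1_inv_def)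
  then have "phase1_inv {g \<in> gens C. Suc (top_dim C) \<le> gen_dim C g} ?s"
    by (simp only: empty)
  then show ?thesis unfolding phase1_def by (rule phase1_inv_fold_dims)
qed

section \<open>Local columns and relative ranks\<close>

lemma phase1_invD:
  assumes "phase1_inv (gens C) s" "g \<in> gens C"
  shows "derived_column C s g (stored s g)" and "lab s g \<noteq> Unlabeled"
    and "lab s g = Global \<Longrightarrow> local_pivot C i g (stored s g) = None"
    and "lab s g = LocalNegative \<Longrightarrow>
      \<exists>h. local_pivot C i g (stored s g) = Some h \<and> lab s h = LocalPositive"
    and "lab s g = LocalPositive \<Longrightarrow>
      \<exists>g'\<in>gens C. lab s g' = LocalNegative \<and> local_pivot C i g' (stored s g') = Some g"
    and "g' \<in> gens C \<Longrightarrow> lab s g = LocalNegative \<Longrightarrow> lab s g' = LocalNegative \<Longrightarrow>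
      local_pivot C i g (stored s g) = local_pivot C i g' (stored s g') \<Longrightarrow> g = g'"
  using assms unfolding phase1_inv_def by blast+

definition restrict_value :: "real \<times> real \<Rightarrow> ('g \<Rightarrow> 'f) \<Rightarrow> 'g \<Rightarrow> 'f" where
  "restrict_value p x = (\<lambda>h. if val C h = p then x h else 0)"

lemma relative_boundary_eq: "relative_boundary C p c = (\<lambda>h. \<Sum>g\<in>gens C. c g * restrict_value p (bd C g) h)"
  by (simp add: relative_boundary_def boundary_def restrict_value_def fun_eq_iff)

text \<open>
  Let \<open>g\<close> be the local pivot of the column \<open>n\<close>. Since \<open>stored s n\<close> is a cycle, the relative boundaries of
  its entries, weighted with the coefficients, add up to zero. Entries of value other than \<open>p\<close> have
  value below \<open>p\<close> and relative boundary zero; the others have index below that of \<open>g\<close>.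
\<close>

lemma positive_column_redundant:
  assumes inv: "phase1_inv (gens C) s"
    and g: "g \<in> level C p k" "lab s g = LocalPositive"
    and W: "chain_subspace F W"
    and lower: "\<And>h. h \<in> level C p k \<Longrightarrow> i h < i g \<Longrightarrow> restrict_value p (bd C h) \<in> W"
  shows "restrict_value p (bd C g) \<in> W"
proof -
  have g': "g \<in> gens C" "val C g = p" "int (gen_dim C g) = k" using g(1) by (auto simp: level_def)
  then obtain n where n: "n \<in> gens C" "local_pivot C i n (stored s n) = Some g"
    using phase1_invD(5)[OF inv g'(1) g(2)] by blast
  note pivot = local_pivot_SomeD[OF n(2)]
  have "derived_column C s n (stored s n)" by (rule phase1_invD(1)[OF inv n(1)])
  then obtain u where u: "u \<in> supported (level C (val C n) (int (gen_dim C n)))" "stored s n = boundary C u"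
    unfolding derived_column_def by blast
  note support = boundary_levelD[OF u(1), folded u(2)]
  have others: "restrict_value p (bd C h) \<in> W" if h: "h \<in> gens C" "h \<noteq> g" "stored s n h \<noteq> 0" for h
  proof (cases "val C h = p")
    case True
    have "int (gen_dim C h) = k" using support(3)[OF h(3)] support(3)[OF pivot(2)] g'(3) by simp
    then have "h \<in> level C p k" using h(1) True by (simp add: level_def)
    moreover have "i h \<le> i g" using pivot(3,4) h True g'(2) by auto
    moreover have "i h \<noteq> i g" using h g'(1) inj_index by (auto simp: inj_on_def)
    ultimately show ?thesis using lower by (simp add: order.strict_iff_order)
  next
    case False
    have "val C h \<le> p" using support(2)[OF h(3)] pivot(3) g'(2) by simp
    then have "bd C h h' = 0" if "val C h' = p" for h'
      using False bd_val[OF h(1), of h'] that by auto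
    then have "restrict_value p (bd C h) = (\<lambda>h'. 0)" by (auto simp: restrict_value_def)
    then show ?thesis using W by (simp add: chain_subspace_def)
  qed
  let ?rest = "\<lambda>h'. \<Sum>h\<in>gens C - {g}. stored s n h * restrict_value p (bd C h) h'"
  have "boundary C (stored s n) h' = 0" for h'
    unfolding u(2) by (simp add: boundary_boundary)
  then have zero: "(\<Sum>h\<in>gens C. stored s n h * restrict_value p (bd C h) h') = 0" for h'
    by (cases "val C h' = p") (simp_all add: boundary_def restrict_value_def)
  have "restrict_value p (bd C g) h' = - inverse (stored s n g) * ?rest h'" for h'
  proof -
    have "stored s n g * restrict_value p (bd C g) h' = - ?rest h'"
      using zero[of h'] unfolding sum.remove[OF finite_gens g'(1)] by (simp only: eq_neg_iff_add_eq_0)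
    then show ?thesis using pivot(2) by (simp add: field_simps)
  qed
  then have eq: "restrict_value p (bd C g) = (\<lambda>h'. - inverse (stored s n g) * ?rest h')" by (rule ext)
  have "?rest \<in> W" using others finite_gens by (intro chain_subspace_sum[OF W]) auto
  then show ?thesis unfolding eq by (rule chain_subspace_smult[OF W])
qed

text \<open>
  The linear map whose matrix consists of the stored columns, restricted to the rows of value \<open>p\<close>.
\<close>

definition column_combination :: "('f, 'g) chunk_state \<Rightarrow> real \<times> real \<Rightarrow> ('g \<Rightarrow> 'f) \<Rightarrow> 'g \<Rightarrow> 'f" where
  "column_combination s p a = (\<lambda>h. \<Sum>g\<in>gens C. a g * restrict_value p (stored s g) h)"

lemma chain_linear_column_combination: "chain_linear (column_combination s p)"
  by (simp add: chain_linear_def column_combination_def distrib_right sum.distrib sum_distrib_left mult.assoc)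

lemma stored_gens:
  assumes "phase1_inv (gens C) s" "g \<in> gens C" "stored s g h \<noteq> 0"
  shows "h \<in> gens C"
proof -
  have "derived_column C s g (stored s g)" by (rule phase1_invD(1)[OF assms(1,2)])
  then obtain u where "stored s g = boundary C u" unfolding derived_column_def by blast
  then show ?thesis using assms(3) boundary_supported[of "{u}"] by (auto simp: supported_def)
qed

lemma column_combination_supported:
  assumes "phase1_inv (gens C) s"
  shows "column_combination s p ` U \<subseteq> supported (gens C)"
proof -
  have "column_combination s p a h = 0" if "h \<notin> gens C" for a h
  proof -
    have "restrict_value p (stored s g) h = 0" if "g \<in> gens C" for g
      using stored_gens[OF assms that, of h] \<open>h \<notin> gens C\<close> by (auto simp: restrict_value_def)
    then show ?thesis by (simp add: column_combination_def)
  qed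
  then show ?thesis by (auto simp: supported_def)
qed

text \<open>
  One inclusion holds because every stored column is a boundary. For the other it is shown by
  induction on the index that each generator \<open>g\<close> of value \<open>p\<close> has its relative boundary in the span:
  it differs by an element of the span from the restricted stored column of \<open>g\<close>. The latter is zero for
  a global column and a spanning vector for a local negative column. A local positive column is
  redundant.
\<close>

lemma relative_boundary_image_eq_negative_span:
  assumes inv: "phase1_inv (gens C) s"
  shows "relative_boundary C p ` supported (level C p k) =
    column_combination s p ` supported (labelled C s LocalNegative p k)"
    (is "?W = ?W'")
proof (rule equalityI)
  let ?L = "level C p k" and ?N = "labelled C s LocalNegative p k"
  have L: "?L \<subseteq> gens C" "finite ?L" and N: "?N \<subseteq> gens C"
    using finite_gens by (auto simp: labelled_def level_def)
  note reduced = phase1_invD(1)[OF inv]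
  have "range (relative_boundary C p) \<subseteq> supported (gens C)"
    using boundary_supported[of UNIV]
    by (auto simp: relative_boundary_def supported_def image_subset_iff split: if_splits)
  then have W: "chain_subspace (gens C) ?W"
    by (intro chain_subspace_image[OF chain_subspace_supported[OF finite_gens L(1)]
          chain_linear_relative_boundary finite_gens]) blast
  have W': "chain_subspace (gens C) ?W'"
    by (rule chain_subspace_image[OF chain_subspace_supported[OF finite_gens N]
          chain_linear_column_combination finite_gens column_combination_supported[OF inv]])
  have "restrict_value p (stored s g) \<in> ?W" if "g \<in> ?N" for g
  proof -
    have g: "g \<in> gens C" "val C g = p" "int (gen_dim C g) = k"
      using that by (auto simp: labelled_def level_def)
    then obtain u where "u \<in> supported ?L" "stored s g = boundary C u"
      using reduced[OF g(1)] unfolding derived_column_def by blast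
    then show ?thesis by (auto simp: restrict_value_def relative_boundary_def)
  qed
  then show "?W' \<subseteq> ?W"
    unfolding column_combination_def
    by (intro image_subsetI chain_subspace_sum[OF W finite_gens]) (simp add: supported_def)
  have stored_W': "restrict_value p (stored s g) \<in> ?W'" if "g \<in> ?N" for g
  proof -
    have "restrict_value p (stored s g) = column_combination s p (\<lambda>h. if h = g then 1 else 0)"
      using that N finite_gens
      by (auto simp: column_combination_def fun_eq_iff if_distrib[of "\<lambda>y. y * _"] cong: if_cong)
    moreover have "(\<lambda>h. if h = g then 1 else 0) \<in> supported ?N"
      using that by (auto simp: supported_def)
    ultimately show ?thesis by (rule image_eqI)
  qed
  have bd_W': "restrict_value p (bd C g) \<in> ?W'" if "g \<in> ?L" for g
    using that
  proof (induction "card {g' \<in> ?L. i g' < i g}" arbitrary: g rule: less_induct)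
    case less
    have g: "g \<in> gens C" "val C g = p" "int (gen_dim C g) = k" using less.prems by (auto simp: level_def)
    have IH: "restrict_value p (bd C g') \<in> ?W'" if "g' \<in> ?L" "i g' < i g" for g'
    proof (rule less.hyps[OF _ that(1)])
      have "{h \<in> ?L. i h < i g'} \<subset> {h \<in> ?L. i h < i g}" using that by auto
      then show "card {h \<in> ?L. i h < i g'} < card {h \<in> ?L. i h < i g}"
        using L(2) by (intro psubset_card_mono) auto
    qed
    obtain a where a: "a \<in> supported ?N" "stored s g = (\<lambda>h. bd C g h + (\<Sum>g\<in>gens C. a g * stored s g h))"
      using reduced[OF g(1)] unfolding derived_column_def g(2,3) by blast
    have bd_g: "restrict_value p (bd C g) =
        (\<lambda>h. restrict_value p (stored s g) h + - 1 * column_combination s p a h)"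
      by (subst a(2)) (auto simp: restrict_value_def column_combination_def fun_eq_iff)
    have Ta: "column_combination s p a \<in> ?W'" using a(1) by simp
    have "lab s g \<noteq> Unlabeled" by (rule phase1_invD(2)[OF inv g(1)])
    then consider "lab s g = Global" | "lab s g = LocalNegative" | "lab s g = LocalPositive"
      by (cases "lab s g") auto
    then show ?case
    proof cases
      case 1
      then have "local_pivot C i g (stored s g) = None" by (rule phase1_invD(3)[OF inv g(1)])
      then have "stored s g h = 0" if "val C h = p" for h
        using stored_gens[OF inv g(1), of h] g(2) that by (auto simp: local_pivot_None_iff)
      then have "restrict_value p (stored s g) = (\<lambda>h. 0)"
        by (auto simp: restrict_value_def)
      then have "restrict_value p (stored s g) \<in> ?W'" using W' by (simp add: chain_subspace_def)
      then show ?thesis unfolding bd_g by (intro chain_subspace_add_smult[OF W' _ Ta])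
    next
      case 2
      then have "g \<in> ?N" using less.prems by (simp add: labelled_def)
      then show ?thesis
        unfolding bd_g by (intro chain_subspace_add_smult[OF W' stored_W' Ta])
    next
      case 3
      then show ?thesis using positive_column_redundant[OF inv less.prems _ W'] IH by blast
    qed
  qed
  then show "?W \<subseteq> ?W'"
    unfolding relative_boundary_eq
    by (intro image_subsetI chain_subspace_sum[OF W' finite_gens]) (simp add: supported_def)
qed

text \<open>
  Among the columns that occur in a combination, take the one whose pivot has the largest index. As
  pivots are distinct, no other column that occurs has an entry at that pivot, so it does not cancel.
\<close>

lemma negative_columns_independent:
  assumes inv: "phase1_inv (gens C) s"
    and a: "a \<in> supported (labelled C s LocalNegative p k)"
    and zero: "column_combination s p a = (\<lambda>h. 0)"
  shows "a = (\<lambda>g. 0)"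
proof (rule ccontr)
  let ?N = "labelled C s LocalNegative p k"
  let ?piv = "\<lambda>g. local_pivot C i g (stored s g)"
  let ?S = "{g \<in> ?N. a g \<noteq> 0}"
  have N: "?N \<subseteq> gens C" "finite ?N" using finite_gens by (auto simp: labelled_def level_def)
  assume "a \<noteq> (\<lambda>g. 0)"
  then have S: "finite ?S" "?S \<noteq> {}" using a N by (auto simp: supported_def fun_eq_iff)
  define g where "g = arg_max_on (\<lambda>g. i (the (?piv g))) ?S"
  note g = arg_max_on_finite[where f = "\<lambda>g. i (the (?piv g))", OF S, folded g_def]
  have pivots: "\<exists>h. ?piv g = Some h" if "g \<in> ?N" for g
  proof -
    have "g \<in> gens C" "lab s g = LocalNegative" using that by (auto simp: labelled_def level_def)
    then show ?thesis using phase1_invD(4)[OF inv] by blast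
  qed
  obtain h where h: "?piv g = Some h" using pivots g(1) by auto
  have vals: "val C g' = p" if "g' \<in> ?N" for g' using that by (simp add: labelled_def level_def)
  note pivot = local_pivot_SomeD[OF h]
  have hp: "val C h = p" using pivot(3) vals g(1) by auto
  have others: "a g' * restrict_value p (stored s g') h = 0" if "g' \<in> gens C" "g' \<noteq> g" for g'
  proof (rule ccontr)
    assume nonzero: "a g' * restrict_value p (stored s g') h \<noteq> 0"
    then have g': "g' \<in> ?N" "a g' \<noteq> 0" "stored s g' h \<noteq> 0"
      using a by (auto simp: supported_def restrict_value_def split: if_splits)
    obtain h' where h': "?piv g' = Some h'" using pivots g'(1) by auto
    have "i h \<le> i h'"
      using local_pivot_SomeD(4)[OF h' pivot(1) g'(3)] hp vals[OF g'(1)] by simp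
    moreover have "i h' \<le> i h" using g(2)[of g'] g' h h' by simp
    ultimately have "h' = h"
      using inj_index pivot(1) local_pivot_SomeD(1)[OF h'] by (auto simp: inj_on_def)
    moreover have "lab s g = LocalNegative" "lab s g' = LocalNegative" "g \<in> gens C"
      using g'(1) g(1) N(1) by (auto simp: labelled_def)
    ultimately have "g' = g"
      using phase1_invD(6)[OF inv, of g g'] that(1) h h' by simp
    then show False using that(2) by simp
  qed
  have "g \<in> gens C" using g(1) N(1) by auto
  then have "column_combination s p a h =
      a g * restrict_value p (stored s g) h + (\<Sum>g'\<in>gens C - {g}. a g' * restrict_value p (stored s g') h)"
    unfolding column_combination_def by (rule sum.remove[OF finite_gens])
  also have "(\<Sum>g'\<in>gens C - {g}. a g' * restrict_value p (stored s g') h) = 0"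
    using others by (intro sum.neutral) blast
  finally have "column_combination s p a h = a g * stored s g h"
    using hp by (simp add: restrict_value_def)
  then show False using zero g(1) pivot(2) by simp
qed

lemma relative_rank_eq_card_negative:
  assumes inv: "phase1_inv (gens C) s"
  shows "relative_rank C p k = card (labelled C s LocalNegative p k)"
proof -
  let ?N = "labelled C s LocalNegative p k" and ?T = "column_combination s p"
  have N: "?N \<subseteq> gens C" "finite ?N" using finite_gens by (auto simp: labelled_def level_def)
  have "{a \<in> supported ?N. ?T a = (\<lambda>h. 0)} = {\<lambda>g. 0}"
    using negative_columns_independent[OF inv, of _ p k]
      chain_linear_zero[OF chain_linear_column_combination[of s p]]
    by (auto simp: supported_def)
  then have "{a \<in> supported ?N. ?T a = (\<lambda>h. 0)} = supported {}"
    by (auto simp: supported_def)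
  moreover have "fdim (?T ` supported ?N) + fdim {a \<in> supported ?N. ?T a = (\<lambda>h. 0)} =
      fdim (supported ?N :: ('g \<Rightarrow> 'f) set)"
    by (rule fdim_image_kernel[OF chain_subspace_supported[OF finite_gens N(1)]
          chain_linear_column_combination finite_gens column_combination_supported[OF inv]])
  ultimately show ?thesis
    unfolding relative_boundary_image_eq_negative_span[OF inv]
    by (simp add: fin_dim_supported(2)[OF N(2)] fin_dim_supported(2)[of "{}"])
qed

lemma card_negative_eq_card_positive:
  assumes inv: "phase1_inv (gens C) s"
  shows "card (labelled C s LocalNegative p (k + 1)) = card (labelled C s LocalPositive p k)"
proof (rule bij_betw_same_card)
  let ?piv = "\<lambda>g. the (local_pivot C i g (stored s g))"
  let ?N = "labelled C s LocalNegative p (k + 1)" and ?P = "labelled C s LocalPositive p k"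
  have dim: "gen_dim C g = Suc (gen_dim C h)" if "g \<in> gens C" "local_pivot C i g (stored s g) = Some h" for g h
    using that(2) by (rule pivot_dim[OF phase1_invD(1)[OF inv that(1)]])
  have negative: "\<exists>h. local_pivot C i g (stored s g) = Some h \<and> h \<in> ?P" if "g \<in> ?N" for g
  proof -
    have g: "g \<in> gens C" "val C g = p" "int (gen_dim C g) = k + 1" "lab s g = LocalNegative"
      using that by (auto simp: labelled_def level_def)
    then obtain h where h: "local_pivot C i g (stored s g) = Some h" "lab s h = LocalPositive"
      using phase1_invD(4)[OF inv] by blast
    then show ?thesis
      using dim[OF g(1) h(1)] local_pivot_SomeD(1,3)[OF h(1)] g by (auto simp: labelled_def level_def)
  qed
  show "bij_betw ?piv ?N ?P"
  proof (rule bij_betw_imageI)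
    show "inj_on ?piv ?N"
    proof (rule inj_onI)
      fix g g' assume g: "g \<in> ?N" "g' \<in> ?N" "?piv g = ?piv g'"
      then have "local_pivot C i g (stored s g) = local_pivot C i g' (stored s g')"
        using negative[OF g(1)] negative[OF g(2)] by auto
      moreover have "g \<in> gens C" "g' \<in> gens C" "lab s g = LocalNegative" "lab s g' = LocalNegative"
        using g(1,2) by (auto simp: labelled_def level_def)
      ultimately show "g = g'" using phase1_invD(6)[OF inv] by blast
    qed
    show "?piv ` ?N = ?P"
    proof (rule equalityI)
      show "?P \<subseteq> ?piv ` ?N"
      proof
        fix h assume "h \<in> ?P"
        then have h: "h \<in> gens C" "val C h = p" "int (gen_dim C h) = k" "lab s h = LocalPositive"
          by (auto simp: labelled_def level_def)
        then obtain g where g: "g \<in> gens C" "lab s g = LocalNegative" "local_pivot C i g (stored s g) = Some h"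
          using phase1_invD(5)[OF inv] by blast
        then have "g \<in> ?N"
          using dim[OF g(1,3)] local_pivot_SomeD(3)[OF g(3)] h by (simp add: labelled_def level_def)
        then show "h \<in> ?piv ` ?N" using g(3) by force
      qed
    qed (use negative in force)
  qed
qed

lemma card_level_split:
  assumes inv: "phase1_inv (gens C) s"
  shows "card (level C p k) = card (labelled C s Global p k) +
    card (labelled C s LocalNegative p k) + card (labelled C s LocalPositive p k)"
proof -
  have fin: "finite (labelled C s l p k)" for l
    using finite_gens by (simp add: labelled_def level_def)
  have "level C p k =
      labelled C s Global p k \<union> (labelled C s LocalNegative p k \<union> labelled C s LocalPositive p k)"
    using phase1_invD(2)[OF inv] label.exhaust by (auto simp: labelled_def level_def)
  moreover have "labelled C s Global p k \<inter>
      (labelled C s LocalNegative p k \<union> labelled C s LocalPositive p k) = {}"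
    "labelled C s LocalNegative p k \<inter> labelled C s LocalPositive p k = {}"
    by (auto simp: labelled_def)
  ultimately show ?thesis using fin by (simp add: card_Un_disjoint)
qed

theorem delta_eq_gamma_chunk: "int (delta C p k) = gamma (chunk C i) p k"
proof -
  let ?s = "phase1 C i"
  have "level (chunk C i) p k = labelled C ?s Global p k"
    by (auto simp: level_def labelled_def chunk_def phase2_def Let_def)
  moreover have "finite (gens (chunk C i))"
    using finite_gens by (simp add: chunk_def Let_def)
  ultimately have "gamma (chunk C i) p k = int (card (labelled C ?s Global p k))"
    using gamma_eq_card_level by metis
  moreover have "delta C p k = card (labelled C ?s Global p k)"
    using delta_relative_rank[of p k] card_level_split[OF phase1_inv_phase1, of p k]
    unfolding relative_rank_eq_card_negative[OF phase1_inv_phase1]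
      card_negative_eq_card_positive[OF phase1_inv_phase1]
    by simp
  ultimately show ?thesis by simp
qed

end

theorem theorem6:
  fixes C :: "('f::field, 'g) bicomplex"
    and i :: "'g \<Rightarrow> 'i::linorder"
    and p :: "real \<times> real"
    and k :: int
  assumes "bifiltered_complex C"
    and "index_function C i"
  shows "int (delta C p k) = gamma (chunk C i) p k"
  by (rule chunk_input.delta_eq_gamma_chunk)
    (intro chunk_input.intro chunk_input_axioms.intro assms)

end
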